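(* Let $\beta:\mathbb R\to(0,+\infty)$ be a smooth function with $\beta(r)>\beta(0)$ for all $r>0$ and $\beta'(0)>0$, let $\mathbf B(q)=\beta\left(\|q\|^2/2\right)$ on $\mathbb R^2$, and let $\mathscr L_{h,\mathbf A}=(-ih\nabla-\mathbf A)^2$ be the magnetic Laplacian with the radial-gauge potential $\mathbf A$ defined in the context. Let $\varphi,P,a_{m,j},\mu_{m,j},\chi,\theta$ be as in the context. For all $(\varepsilon,m,J)\in(0,1)\times\mathbb N\times\mathbb N$, there exist $C>0$ and $h_0>0$ such that, for all $h\in(0,h_0)$, $$\left\|e^{\varepsilon P/h}\left(\mathscr L_{h,\mathbf A}-\lambda^J_{h,m}\right)\Upsilon^J_{h,m}\right\|_{L^2(\mathbb R^2)}\le Ch^{J+2},$$ where $$\lambda^J_{h,m}=h\sum_{j=0}^J\mu_{m,j}h^j,\qquad \Upsilon^J_{h,m}(q)=\chi\left(\tfrac{\|q\|^2}{2}\right)e^{im\theta(q)}\left(\tfrac{\|q\|^2}{2}\right)^{\frac m2}e^{-P(q)/h}\sum_{j=0}^Ja_{m,j}\left(\tfrac{\|q\|^2}{2}\right)h^j.$$ In particular, $\left\|\left(\mathscr L_{h,\mathbf A}-\lambda^J_{h,m}\right)\Upsilon^J_{h,m}\right\|_{L^2(\mathbb R^2)}\le Ch^{J+2}$.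
   Context: $\mathbb N=\{0,1,2,\dots\}$. The potential is $\mathbf A=(A_1,A_2)$ with $A_1(q)=-q_2\,\alpha(q)$, $A_2(q)=q_1\,\alpha(q)$, $\alpha(q)=\int_0^1t\,\mathbf B(tq)\,dt$, so that $\partial_{q_1}A_2-\partial_{q_2}A_1=\mathbf B$. $\mathscr L_{h,\mathbf A}$ denotes the self-adjoint realization on $L^2(\mathbb R^2)$ (the operator is essentially self-adjoint on $C_0^\infty(\mathbb R^2)$). $\theta(q)=\arg(q_1+iq_2)$. $\varphi(\rho)=\frac12\int_0^\rho\int_0^1\beta(\xi\tau)\,d\xi\,d\tau$ for $\rho\ge0$ and $P(q)=\varphi(\|q\|^2/2)$. WKB coefficients: put $a(\rho)=\int_0^\rho\beta(s)\,ds$, let $F$ be the smooth extension to $[0,\infty)$ of $\frac{\beta(0)-\beta(\rho)}{2a(\rho)}$, and $E(\rho)=\exp\int_0^\rho F(s)\,ds$. Then $\mu_{m,0}=\beta(0)$, $a_{m,0}=E$, and inductively for $n\ge0$: $\mu_{m,n+1}=-(2m+2)\,a_{m,n}'(0)$ and $a_{m,n+1}(\rho)=E(\rho)\int_0^\rho E(\tau)^{-1}g_{n}(\tau)\,d\tau$, where $g_{n}$ is the smooth extension to $[0,\infty)$ of $$\frac{(2m+2)a_{m,n}'+2\rho\,a_{m,n}''+\sum_{j=1}^{n+1}\mu_{m,j}a_{m,n+1-j}}{2a(\rho)}.$$ Cutoff: $K>0$ is fixed and $\chi$ is a smooth function on $[0,\infty)$ with $\chi=1$ on $[0,K]$ and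 $\chi=0$ on $[K+1,\infty)$. *)

theory Defs
  imports "HOL-Analysis.Analysis"
begin

text \<open>The derivatives are taken within \<open>S\<close>; for \<open>S = {0..}\<close> this means one-sided
  derivatives at \<open>0\<close>, and values outside \<open>S\<close> are irrelevant.\<close>

definition smooth_on :: "real set \<Rightarrow> (real \<Rightarrow> real) \<Rightarrow> bool" where
  "smooth_on S f \<longleftrightarrow>
     (\<exists>D. D 0 = f \<and>
       (\<forall>n::nat. \<forall>x\<in>S. (D n has_real_derivative D (Suc n) x) (at x within S)))"

text \<open>The result of \<open>smooth_ext\<close> is determined uniquely on \<open>[0,\<infinity>)\<close> whenever
  a smooth extension exists; its values on the negative axis are never used.\<close>

definition smooth_ext :: "(real \<Rightarrow> real) \<Rightarrow> real \<Rightarrow> real" where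
  "smooth_ext f = (SOME g. smooth_on {0..} g \<and> (\<forall>\<rho>>0. g \<rho> = f \<rho>))"

definition half_line_deriv :: "(real \<Rightarrow> real) \<Rightarrow> real \<Rightarrow> real" where
  "half_line_deriv f \<rho> = vector_derivative f (at \<rho> within {0..})"

definition partial :: "2 \<Rightarrow> (real^2 \<Rightarrow> complex) \<Rightarrow> real^2 \<Rightarrow> complex" where
  "partial k u q = frechet_derivative u (at q) (axis k 1)"

fun C_k :: "nat \<Rightarrow> (real^2 \<Rightarrow> complex) \<Rightarrow> bool" where
  "C_k 0 u \<longleftrightarrow> continuous_on UNIV u"
| "C_k (Suc n) u \<longleftrightarrow> u differentiable_on UNIV \<and> (\<forall>k. C_k n (partial k u))"

definition test_functions :: "(real^2 \<Rightarrow> complex) set" where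
  "test_functions = {u. (\<forall>n. C_k n u) \<and> compact (closure {q. u q \<noteq> 0})}"

definition L2_functions :: "(real^2 \<Rightarrow> complex) set" where
  "L2_functions =
     {u. u \<in> borel_measurable lborel \<and> integrable lborel (\<lambda>q. (cmod (u q))\<^sup>2)}"

text \<open>Meaningful on \<open>L2_functions\<close> only: the Bochner integral of a non-integrable function is \<open>0\<close>.\<close>

definition L2_norm :: "(real^2 \<Rightarrow> complex) \<Rightarrow> real" where
  "L2_norm u = sqrt (\<integral>q. (cmod (u q))\<^sup>2 \<partial>lborel)"

definition L2_tendsto :: "(nat \<Rightarrow> real^2 \<Rightarrow> complex) \<Rightarrow> (real^2 \<Rightarrow> complex) \<Rightarrow> bool" where
  "L2_tendsto f u \<longleftrightarrow> (\<forall>n. f n \<in> L2_functions) \<and> u \<in> L2_functions \<and>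
     (\<lambda>n. L2_norm (\<lambda>q. f n q - u q)) \<longlonglongrightarrow> 0"

definition momentum :: "real \<Rightarrow> (real^2 \<Rightarrow> real^2) \<Rightarrow> 2 \<Rightarrow> (real^2 \<Rightarrow> complex) \<Rightarrow> real^2 \<Rightarrow> complex"
  where "momentum h A k u q = - \<i> * of_real h * partial k u q - of_real (A q $ k) * u q"

definition magnetic_expr :: "real \<Rightarrow> (real^2 \<Rightarrow> real^2) \<Rightarrow> (real^2 \<Rightarrow> complex) \<Rightarrow> real^2 \<Rightarrow> complex"
  where "magnetic_expr h A u q = (\<Sum>k\<in>UNIV. momentum h A k (momentum h A k u) q)"

text \<open>Graph of the closure in \<open>L\<^sup>2\<close> of the differential expression on test functions.
  Since the expression is essentially self-adjoint there, this closure is the self-adjoint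
  realization.  Elements of \<open>L\<^sup>2\<close> are represented by functions, so the graph determines the
  image of an element of the domain up to a null set.\<close>

definition magnetic_laplacian ::
    "real \<Rightarrow> (real^2 \<Rightarrow> real^2) \<Rightarrow> ((real^2 \<Rightarrow> complex) \<times> (real^2 \<Rightarrow> complex)) set" where
  "magnetic_laplacian h A =
     {(u, v). \<exists>f. (\<forall>n. f n \<in> test_functions) \<and> L2_tendsto f u \<and>
                L2_tendsto (\<lambda>n. magnetic_expr h A (f n)) v}"

definition magnetic_field :: "(real \<Rightarrow> real) \<Rightarrow> real^2 \<Rightarrow> real" where
  "magnetic_field \<beta> q = \<beta> ((norm q)\<^sup>2 / 2)"

definition radial_alpha :: "(real \<Rightarrow> real) \<Rightarrow> real^2 \<Rightarrow> real" where
  "radial_alpha \<beta> q = integral {0..1} (\<lambda>t. t * magnetic_field \<beta> (t *\<^sub>R q))"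

definition radial_potential :: "(real \<Rightarrow> real) \<Rightarrow> real^2 \<Rightarrow> real^2" where
  "radial_potential \<beta> q = vector [- (q $ 2) * radial_alpha \<beta> q, q $ 1 * radial_alpha \<beta> q]"

definition phase :: "(real \<Rightarrow> real) \<Rightarrow> real \<Rightarrow> real" where
  "phase \<beta> \<rho> = 1/2 * integral {0..\<rho>} (\<lambda>\<tau>. integral {0..1} (\<lambda>\<xi>. \<beta> (\<xi> * \<tau>)))"

definition wkb_weight :: "(real \<Rightarrow> real) \<Rightarrow> real^2 \<Rightarrow> real" where
  "wkb_weight \<beta> q = phase \<beta> ((norm q)\<^sup>2 / 2)"

definition flux :: "(real \<Rightarrow> real) \<Rightarrow> real \<Rightarrow> real" where
  "flux \<beta> \<rho> = integral {0..\<rho>} \<beta>"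

definition wkb_F :: "(real \<Rightarrow> real) \<Rightarrow> real \<Rightarrow> real" where
  "wkb_F \<beta> = smooth_ext (\<lambda>\<rho>. (\<beta> 0 - \<beta> \<rho>) / (2 * flux \<beta> \<rho>))"

definition wkb_E :: "(real \<Rightarrow> real) \<Rightarrow> real \<Rightarrow> real" where
  "wkb_E \<beta> \<rho> = exp (integral {0..\<rho>} (wkb_F \<beta>))"

function wkb_mu :: "(real \<Rightarrow> real) \<Rightarrow> nat \<Rightarrow> nat \<Rightarrow> real"
  and wkb_a :: "(real \<Rightarrow> real) \<Rightarrow> nat \<Rightarrow> nat \<Rightarrow> real \<Rightarrow> real" where
  "wkb_mu \<beta> m 0 = \<beta> 0"
| "wkb_mu \<beta> m (Suc n) = - (2 * real m + 2) * half_line_deriv (wkb_a \<beta> m n) 0"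
| "wkb_a \<beta> m 0 = wkb_E \<beta>"
| "wkb_a \<beta> m (Suc n) = (\<lambda>\<rho>. wkb_E \<beta> \<rho> * integral {0..\<rho>} (\<lambda>\<tau>. inverse (wkb_E \<beta> \<tau>) *
     smooth_ext (\<lambda>\<sigma>.
       ((2 * real m + 2) * half_line_deriv (wkb_a \<beta> m n) \<sigma>
        + 2 * \<sigma> * half_line_deriv (half_line_deriv (wkb_a \<beta> m n)) \<sigma>
        + (\<Sum>j\<in>{1..n + 1}. wkb_mu \<beta> m j * wkb_a \<beta> m (n + 1 - j) \<sigma>))
       / (2 * flux \<beta> \<sigma>)) \<tau>))"
  by pat_completeness auto
termination
  by (relation "Wellfounded.measure (\<lambda>x. case x of Inl (_, _, n) \<Rightarrow> 2 * n - 1 | Inr (_, _, n) \<Rightarrow> 2 * n)") auto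

definition wkb_eigenvalue :: "(real \<Rightarrow> real) \<Rightarrow> nat \<Rightarrow> nat \<Rightarrow> real \<Rightarrow> real" where
  "wkb_eigenvalue \<beta> m J h = h * (\<Sum>j\<in>{0..J}. wkb_mu \<beta> m j * h ^ j)"

definition polar_angle :: "real^2 \<Rightarrow> real" where
  "polar_angle q = Arg (Complex (q $ 1) (q $ 2))"

text \<open>The factor $\rho^{m/2}$ is written \<open>sqrt \<rho> ^ m\<close>, because \<open>0 powr 0 = 0\<close> would give the wrong
  value at the origin for \<open>m = 0\<close>.\<close>

definition wkb_quasimode ::
    "(real \<Rightarrow> real) \<Rightarrow> (real \<Rightarrow> real) \<Rightarrow> nat \<Rightarrow> nat \<Rightarrow> real \<Rightarrow> real^2 \<Rightarrow> complex" where
  "wkb_quasimode \<beta> chi m J h q =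
     of_real (chi ((norm q)\<^sup>2 / 2)) * exp (\<i> * of_nat m * of_real (polar_angle q)) *
     of_real (sqrt ((norm q)\<^sup>2 / 2) ^ m * exp (- wkb_weight \<beta> q / h) *
              (\<Sum>j\<in>{0..J}. wkb_a \<beta> m j ((norm q)\<^sup>2 / 2) * h ^ j))"

end

theory Submission
  imports Defs
begin

text \<open>
  With \<open>\<rho> = \<parallel>q\<parallel>\<^sup>2/2\<close> and \<open>z = q\<^sub>1 + iq\<^sub>2\<close>, conjugating the magnetic Laplacian by
  \<open>z\<^sup>m exp (-P/h)\<close> on radial functions gives
  \<open>h (2 a \<partial> + \<beta>) - h\<^sup>2 (2 \<rho> \<partial>\<^sup>2 + (2 m + 2) \<partial>)\<close> because \<open>2 \<rho> \<phi>' = a\<close>.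
  The WKB coefficients solve the resulting transport equations, so where the cutoff equals \<open>1\<close> the
  residual is \<open>O(h\<^bsup>J+2\<^esup>) exp (-P/h)\<close>; where it varies, \<open>P\<close> is bounded below by a positive constant
  and the residual is exponentially small even after multiplication by \<open>exp (\<epsilon> P/h)\<close>.
  The quasimode is a test function, since \<open>z\<^sup>m\<close> times a smooth function of \<open>\<rho>\<close> is smooth, so the
  closure of the operator acts on it as the differential expression once the latter is known to be
  closable, which follows from its symmetry on test functions.
\<close>

subsection \<open>Smooth functions on a half line\<close>

text \<open>The delicate point is the origin. The polar angle jumps there, which the passage to the
  power of \<open>z\<close> cures. The flux, by which the transport equations divide, vanishes
  there, and the cure has two halves. First, \<open>flux \<beta> r = r * mean r\<close> with
  \<open>mean\<close> smooth and positive, so dividing by the flux amounts to dividing by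
  \<open>r\<close>, and Hadamard's lemma permits this when the numerator vanishes at 0. Second, the
  numbers \<open>wkb_mu\<close> are exactly the solvability constants that make each numerator
  vanish. The operator is given as a closure, hence as a relation, and the estimate is claimed for
  every image \<open>v\<close>. So single-valuedness up to null sets has to be proved before a
  computation with the differential expression says anything about \<open>v\<close>. Count of
  powers: one factor \<open>h\<close> is common to the whole residual, and the transport equations
  remove the orders 0 to \<open>J\<close> from the rest, which leaves \<open>h ^ (J + 2)\<close>.
  Where the cutoff varies, the weight leaves the exponent \<open>- (1 - \<epsilon>) P / h\<close>,
  and a single term of the exponential series trades the resulting smallness for the same power of
  \<open>h\<close>.\<close>

lemma smooth_on_derivD:
  assumes "smooth_on S f"
  shows "\<exists>f'. smooth_on S f' \<and> (\<forall>x\<in>S. (f has_real_derivative f' x) (at x within S))"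
proof -
  obtain D where D: "D 0 = f"
    "\<And>n x. x \<in> S \<Longrightarrow> (D n has_real_derivative D (Suc n) x) (at x within S)"
    using assms unfolding smooth_on_def by blast
  have "smooth_on S (D (Suc 0))"
    unfolding smooth_on_def by (rule exI[of _ "\<lambda>n. D (Suc n)"]) (use D(2) in auto)
  then show ?thesis using D(2)[of _ 0] D(1) by blast
qed

text \<open>Coinduction for smoothness: a derivative operator \<open>d\<close> is chosen on the
  family \<open>F\<close>, and its iterates applied to \<open>f\<close> form the tower that the
  definition asks for. No formula for higher derivatives is ever written down.\<close>

lemma smooth_on_coinduct:
  assumes "f \<in> F"
    and step: "\<And>g. g \<in> F \<Longrightarrow> \<exists>g'\<in>F. \<forall>x\<in>S. (g has_real_derivative g' x) (at x within S)"
  shows "smooth_on S f"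
proof -
  obtain d where d: "\<And>g. g \<in> F \<Longrightarrow> d g \<in> F"
    "\<And>g x. g \<in> F \<Longrightarrow> x \<in> S \<Longrightarrow> (g has_real_derivative d g x) (at x within S)"
    using step by metis
  have "(d ^^ n) f \<in> F" for n
    by (induction n) (use d assms(1) in auto)
  then show ?thesis
    unfolding smooth_on_def by (intro exI[of _ "\<lambda>n. (d ^^ n) f"]) (auto intro: d)
qed

lemma smooth_onI_deriv:
  assumes "smooth_on S f'" "\<And>x. x \<in> S \<Longrightarrow> (f has_real_derivative f' x) (at x within S)"
  shows "smooth_on S f"
proof (rule smooth_on_coinduct)
  show "f \<in> insert f {g. smooth_on S g}" by simp
  show "\<exists>g'\<in>insert f {g. smooth_on S g}. \<forall>x\<in>S. (g has_real_derivative g' x) (at x within S)"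
    if "g \<in> insert f {g. smooth_on S g}" for g
    using that
  proof
    assume "g = f" then show ?thesis using assms by auto
  next
    assume "g \<in> {g. smooth_on S g}" then show ?thesis using smooth_on_derivD[of S g] by blast
  qed
qed

text \<open>The tower in \<open>smooth_on\<close> starts with \<open>f\<close> itself as a total
  function, so insensitivity to values outside \<open>S\<close> needs an argument: only the first
  derivative statement mentions \<open>f\<close>, and a derivative within \<open>S\<close> sees only
  \<open>S\<close>.\<close>

lemma smooth_on_cong:
  assumes "smooth_on S f" "\<And>x. x \<in> S \<Longrightarrow> g x = f x"
  shows "smooth_on S g"
proof -
  obtain f' where f': "smooth_on S f'" "\<And>x. x \<in> S \<Longrightarrow> (f has_real_derivative f' x) (at x within S)"
    using smooth_on_derivD[OF assms(1)] by blast
  have "(g has_real_derivative f' x) (at x within S)" if "x \<in> S" for x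
    using f'(2)[OF that] has_field_derivative_transform_within[of f "f' x" x S 1 g] assms(2) that
    by simp
  then show ?thesis by (rule smooth_onI_deriv[OF f'(1)])
qed

lemma smooth_on_subset: "smooth_on S f \<Longrightarrow> T \<subseteq> S \<Longrightarrow> smooth_on T f"
  unfolding smooth_on_def using DERIV_subset by (metis subsetD)

lemma smooth_on_imp_continuous_on: "smooth_on S f \<Longrightarrow> continuous_on S f"
  using smooth_on_derivD DERIV_continuous_on by metis

text \<open>The family for the coinduction. The derivative of each generator is again built from the
  generators, so the family consists of smooth functions, and its introduction rules become the
  closure properties of \<open>smooth_on\<close>.\<close>

inductive_set smooth_closure :: "real set \<Rightarrow> (real \<Rightarrow> real) set" for S where
  base: "smooth_on S f \<Longrightarrow> f \<in> smooth_closure S"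
| const: "(\<lambda>x. c) \<in> smooth_closure S"
| ident: "(\<lambda>x. x) \<in> smooth_closure S"
| add: "f \<in> smooth_closure S \<Longrightarrow> g \<in> smooth_closure S \<Longrightarrow> (\<lambda>x. f x + g x) \<in> smooth_closure S"
| mult: "f \<in> smooth_closure S \<Longrightarrow> g \<in> smooth_closure S \<Longrightarrow> (\<lambda>x. f x * g x) \<in> smooth_closure S"
| exp: "f \<in> smooth_closure S \<Longrightarrow> (\<lambda>x. exp (f x)) \<in> smooth_closure S"
| inv: "f \<in> smooth_closure S \<Longrightarrow> (\<And>x. x \<in> S \<Longrightarrow> f x \<noteq> 0) \<Longrightarrow>
    (\<lambda>x. inverse (f x)) \<in> smooth_closure S"

lemma smooth_closure_deriv:
  "g \<in> smooth_closure S \<Longrightarrow>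
    \<exists>g'\<in>smooth_closure S. \<forall>x\<in>S. (g has_real_derivative g' x) (at x within S)"
proof (induction rule: smooth_closure.induct)
  case (base f)
  then show ?case using smooth_on_derivD smooth_closure.base by metis
next
  case (const c)
  show ?case by (rule bexI[of _ "\<lambda>x. 0"]) (auto intro: smooth_closure.const)
next
  case ident
  show ?case by (rule bexI[of _ "\<lambda>x. 1"]) (auto intro: smooth_closure.const)
next
  case (add f g)
  then obtain f' g' where "f' \<in> smooth_closure S" "g' \<in> smooth_closure S"
    "\<forall>x\<in>S. (f has_real_derivative f' x) (at x within S)"
    "\<forall>x\<in>S. (g has_real_derivative g' x) (at x within S)" by auto
  then show ?case
    by (intro bexI[of _ "\<lambda>x. f' x + g' x"] ballI smooth_closure.add)
       (auto intro!: derivative_eq_intros)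
next
  case (mult f g)
  then obtain f' g' where "f' \<in> smooth_closure S" "g' \<in> smooth_closure S"
    "\<forall>x\<in>S. (f has_real_derivative f' x) (at x within S)"
    "\<forall>x\<in>S. (g has_real_derivative g' x) (at x within S)" by auto
  then show ?case using mult.hyps
    by (intro bexI[of _ "\<lambda>x. f' x * g x + g' x * f x"] ballI smooth_closure.add smooth_closure.mult)
       (auto intro!: derivative_eq_intros)
next
  case (exp f)
  then obtain f' where "f' \<in> smooth_closure S"
    "\<forall>x\<in>S. (f has_real_derivative f' x) (at x within S)" by auto
  then show ?case using exp.hyps
    by (intro bexI[of _ "\<lambda>x. exp (f x) * f' x"] ballI smooth_closure.exp smooth_closure.mult)
       (auto intro!: derivative_eq_intros)
next
  case (inv f)
  then obtain f' where f': "f' \<in> smooth_closure S"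
    "\<forall>x\<in>S. (f has_real_derivative f' x) (at x within S)" by auto
  have "(\<lambda>x. (- 1) * (inverse (f x) * f' x * inverse (f x))) \<in> smooth_closure S"
    by (intro smooth_closure.mult smooth_closure.inv smooth_closure.const inv.hyps f')
  moreover have "((\<lambda>x. inverse (f x)) has_real_derivative
      (- 1) * (inverse (f x) * f' x * inverse (f x))) (at x within S)" if "x \<in> S" for x
    using DERIV_inverse'[OF f'(2)[rule_format, OF that] inv.hyps(2)[OF that]]
    by (simp add: mult.assoc)
  ultimately show ?case by (intro bexI ballI)
qed

lemma smooth_closure_eq: "smooth_closure S = {f. smooth_on S f}"
  using smooth_on_coinduct[OF _ smooth_closure_deriv] smooth_closure.base by blast

lemmas smooth_on_intros = smooth_closure.intros[unfolded smooth_closure_eq mem_Collect_eq]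

lemma smooth_on_uminus: "smooth_on S f \<Longrightarrow> smooth_on S (\<lambda>x. - f x)"
  using smooth_on_intros(5)[OF smooth_on_intros(2)[where c = "-1"], of S f] by simp

lemma smooth_on_diff: "smooth_on S f \<Longrightarrow> smooth_on S g \<Longrightarrow> smooth_on S (\<lambda>x. f x - g x)"
  using smooth_on_intros(4)[OF _ smooth_on_uminus, of S f g] by simp

lemma smooth_on_sum: "(\<And>i. i \<in> I \<Longrightarrow> smooth_on S (f i)) \<Longrightarrow> smooth_on S (\<lambda>x. \<Sum>i\<in>I. f i x)"
  by (induction I rule: infinite_finite_induct) (auto intro: smooth_on_intros(2,4))

lemmas smooth_intros = smooth_on_intros(2-7) smooth_on_uminus smooth_on_diff smooth_on_sum

text \<open>Differentiation under the integral sign; the tower is the integral of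
  \<open>\<xi> ^ n * D n (\<xi> * x)\<close>, one factor \<open>\<xi>\<close> coming from each
  application of the chain rule.\<close>

lemma smooth_on_average:
  assumes "smooth_on {0..} f"
  shows "smooth_on {0..} (\<lambda>x. integral {0..1} (\<lambda>\<xi>. f (\<xi> * x)))"
proof -
  obtain D where D: "D 0 = f"
    "\<And>n x. x \<in> {0..} \<Longrightarrow> (D n has_real_derivative D (Suc n) x) (at x within {0..})"
    using assms unfolding smooth_on_def by blast
  have cont: "continuous_on {0..} (D n)" for n
    using D(2) by (rule DERIV_continuous_on)
  have contp: "continuous_on ({0..} \<times> cbox 0 1) (\<lambda>(x, \<xi>). \<xi> ^ n * D k (\<xi> * x))" for n k
    unfolding split_beta
    by (intro continuous_intros continuous_on_compose2[OF cont]) auto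
  have "((\<lambda>x. integral (cbox 0 1) (\<lambda>\<xi>. \<xi> ^ n * D n (\<xi> * x))) has_field_derivative
         integral (cbox 0 1) (\<lambda>\<xi>. \<xi> ^ Suc n * D (Suc n) (\<xi> * x0))) (at x0 within {0..})"
    if "x0 \<in> {0..}" for x0 n
  proof (rule leibniz_rule_field_derivative)
    \<comment> \<open>Scaling by a nonnegative \<open>\<xi>\<close> maps the half line into itself,
      so the one-sided derivative of \<open>D n\<close> suffices for the chain rule, also at
      \<open>\<xi> = 0\<close>, where the image is a single point.\<close>
    fix x \<xi> :: real assume x: "x \<in> {0..}" and \<xi>: "\<xi> \<in> cbox 0 1"
    have "(*) \<xi> ` {0..} \<subseteq> {0..}" using \<xi> by auto
    then have "(D n has_real_derivative D (Suc n) (\<xi> * x)) (at (\<xi> * x) within (*) \<xi> ` {0..})"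
      using D(2)[of "\<xi> * x" n] x \<xi> by (auto intro: DERIV_subset)
    then have "(D n \<circ> (*) \<xi> has_real_derivative D (Suc n) (\<xi> * x) * \<xi>) (at x within {0..})"
      by (rule DERIV_image_chain) (auto intro!: derivative_eq_intros)
    then show "((\<lambda>x. \<xi> ^ n * D n (\<xi> * x)) has_field_derivative \<xi> ^ Suc n * D (Suc n) (\<xi> * x))
        (at x within {0..})"
      by (auto intro!: derivative_eq_intros simp: o_def)
  next
    fix x :: real assume x: "x \<in> {0..}"
    show "(\<lambda>\<xi>. \<xi> ^ n * D n (\<xi> * x)) integrable_on cbox 0 1"
      using x by (intro integrable_continuous continuous_intros continuous_on_compose2[OF cont]) auto
  qed (use that contp[of "Suc n" "Suc n"] in auto)
  then show ?thesis
    unfolding smooth_on_def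
    by (intro exI[of _ "\<lambda>n x. integral {0..1} (\<lambda>\<xi>. \<xi> ^ n * D n (\<xi> * x))"]) (simp add: D(1))
qed

lemma at_within_half_line_neq_bot: "0 \<le> x \<Longrightarrow> at x within {0::real..} \<noteq> bot"
  using at_le[of "{x<..}" "{0..}" x] trivial_limit_at_right_real[of x]
  by (auto simp: bot_unique subset_eq)

lemma half_line_deriv_eq:
  assumes "(f has_real_derivative d) (at x within {0..})" "0 \<le> x"
  shows "half_line_deriv f x = d"
  unfolding half_line_deriv_def using assms at_within_half_line_neq_bot
  by (intro vector_derivative_within) (auto simp: has_real_derivative_iff_has_vector_derivative)

text \<open>Connects the derivative used in the WKB recursion with the abstract tower. The two agree
  only on the half line, hence the appeal to \<open>smooth_on_cong\<close>.\<close>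

lemma smooth_on_half_line_deriv:
  assumes "smooth_on {0..} f"
  shows "smooth_on {0..} (half_line_deriv f)"
    and "0 \<le> x \<Longrightarrow> (f has_real_derivative half_line_deriv f x) (at x within {0..})"
proof -
  obtain f' where f': "smooth_on {0..} f'" 
    "\<And>x. 0 \<le> x \<Longrightarrow> (f has_real_derivative f' x) (at x within {0..})"
    using smooth_on_derivD[OF assms] by auto
  have eq: "half_line_deriv f x = f' x" if "0 \<le> x" for x
    using half_line_deriv_eq f'(2) that by blast
  show "smooth_on {0..} (half_line_deriv f)"
    by (rule smooth_on_cong[OF f'(1)]) (simp add: eq)
  show "0 \<le> x \<Longrightarrow> (f has_real_derivative half_line_deriv f x) (at x within {0..})"
    by (simp add: eq f'(2))
qed

text \<open>A witness \<open>g\<close> makes the choice operator deliver a genuine extension.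
  Equality with \<open>f\<close> is claimed for positive arguments only, since \<open>f\<close> may
  be a quotient 0/0 at the origin.\<close>

lemma smooth_ext_eqI:
  assumes "smooth_on {0..} g" "\<And>x. 0 < x \<Longrightarrow> g x = f x"
  shows "smooth_on {0..} (smooth_ext f)" "0 < x \<Longrightarrow> smooth_ext f x = f x"
proof -
  have "smooth_on {0..} (smooth_ext f) \<and> (\<forall>x>0. smooth_ext f x = f x)"
    unfolding smooth_ext_def
    using someI[of "\<lambda>g. smooth_on {0..} g \<and> (\<forall>x>0. g x = f x)" g] assms by blast
  then show "smooth_on {0..} (smooth_ext f)" "0 < x \<Longrightarrow> smooth_ext f x = f x" by auto
qed

lemma integral_has_half_line_derivative:
  fixes g :: "real \<Rightarrow> real"
  assumes "continuous_on {0..} g" "0 \<le> x"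
  shows "((\<lambda>u. integral {0..u} g) has_real_derivative g x) (at x within {0..})"
proof -
  have "((\<lambda>u. integral {0..u} g) has_real_derivative g x) (at x within {0..x + 1})"
    using assms by (intro integral_has_real_derivative continuous_on_subset[OF assms(1)]) auto
  \<comment> \<open>The fundamental theorem is stated for bounded intervals; near \<open>x\<close>
    the interval ending at \<open>x + 1\<close> and the half line coincide.\<close>
  moreover have "at x within {0..x + 1} = at x within {0..}"
    by (rule at_within_nhd[of _ "{..<x + 1}"]) auto
  ultimately show ?thesis by simp
qed

lemma smooth_on_integral:
  "smooth_on {0..} g \<Longrightarrow> smooth_on {0..} (\<lambda>x. integral {0..x} g)"
  by (rule smooth_onI_deriv[of _ g])
     (auto intro: integral_has_half_line_derivative smooth_on_imp_continuous_on)

text \<open>The fundamental theorem of calculus along the segment from 0 to \<open>x\<close>,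
  parametrised by \<open>\<xi> * x\<close>.\<close>

lemma increment_eq_average:
  fixes f :: "real \<Rightarrow> real"
  assumes "\<And>x. 0 \<le> x \<Longrightarrow> (f has_real_derivative f' x) (at x within {0..})" "0 \<le> x"
  shows "f x - f 0 = x * integral {0..1} (\<lambda>\<xi>. f' (\<xi> * x))"
proof -
  have "((\<lambda>\<xi>. f' (\<xi> * x) * x) has_integral f (1 * x) - f (0 * x)) {0..1}"
  proof (rule fundamental_theorem_of_calculus)
    fix \<xi> :: real assume \<xi>: "\<xi> \<in> {0..1}"
    have "(\<lambda>\<xi>. \<xi> * x) ` {0..1} \<subseteq> {0..}" using \<open>0 \<le> x\<close> by auto
    then have "(f has_real_derivative f' (\<xi> * x)) (at (\<xi> * x) within (\<lambda>\<xi>. \<xi> * x) ` {0..1})"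
      using assms(1)[of "\<xi> * x"] \<open>0 \<le> x\<close> \<xi> by (auto intro: DERIV_subset)
    then have "(f \<circ> (\<lambda>\<xi>. \<xi> * x) has_real_derivative f' (\<xi> * x) * x) (at \<xi> within {0..1})"
      by (rule DERIV_image_chain) (auto intro!: derivative_eq_intros)
    then show "((\<lambda>\<xi>. f (\<xi> * x)) has_vector_derivative f' (\<xi> * x) * x) (at \<xi> within {0..1})"
      by (simp add: has_real_derivative_iff_has_vector_derivative o_def)
  qed simp
  then show ?thesis by (simp add: integral_unique mult.commute flip: integral_mult_right)
qed

text \<open>Hadamard's lemma on the half line: the quotient is the average of the derivative, hence
  smooth up to 0.\<close>

lemma smooth_on_factor_ident:
  assumes "smooth_on {0..} f" "f 0 = 0"
  obtains g where "smooth_on {0..} g" "\<And>x. 0 \<le> x \<Longrightarrow> f x = x * g x"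
proof -
  obtain f' where f': "smooth_on {0..} f'"
    "\<And>x. 0 \<le> x \<Longrightarrow> (f has_real_derivative f' x) (at x within {0..})"
    using smooth_on_derivD[OF assms(1)] by auto
  show thesis
    using that[OF smooth_on_average[OF f'(1)]] increment_eq_average[of f f'] f'(2) assms(2) by simp
qed

lemma integral_pos_of_continuous:
  fixes f :: "real \<Rightarrow> real"
  assumes "continuous_on {a..b} f" "a < b" "\<And>x. x \<in> {a..b} \<Longrightarrow> 0 < f x"
  shows "0 < integral {a..b} f"
proof -
  obtain x where x: "x \<in> {a..b}" "\<And>y. y \<in> {a..b} \<Longrightarrow> f x \<le> f y"
    using continuous_attains_inf[of "{a..b}" f] assms by auto
  have "0 < (b - a) * f x" using assms x by simp
  also have "\<dots> = integral {a..b} (\<lambda>_. f x)" using assms(2) by simp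
  also have "\<dots> \<le> integral {a..b} f"
    using assms x by (intro integral_le integrable_continuous_interval) auto
  finally show ?thesis .
qed

subsection \<open>The WKB coefficients\<close>

locale wkb_profile =
  fixes \<beta> :: "real \<Rightarrow> real"
  assumes smooth: "smooth_on {0..} \<beta>"
    and pos: "\<And>r. 0 \<le> r \<Longrightarrow> 0 < \<beta> r"
begin

text \<open>The flux divided by \<open>r\<close>, continued over 0, and at the same time twice the
  derivative of the phase. Its positivity says that the zero of the flux at 0 is simple.\<close>

definition mean :: "real \<Rightarrow> real" where
  "mean r = integral {0..1} (\<lambda>\<xi>. \<beta> (\<xi> * r))"

lemma continuous: "continuous_on {0..} \<beta>"
  by (rule smooth_on_imp_continuous_on[OF smooth])

lemma smooth_on_mean: "smooth_on {0..} mean"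
  unfolding mean_def by (rule smooth_on_average[OF smooth])

lemma mean_0: "mean 0 = \<beta> 0"
  by (simp add: mean_def)

lemma mean_pos: "0 \<le> r \<Longrightarrow> 0 < mean r"
  unfolding mean_def
  by (intro integral_pos_of_continuous continuous_on_compose2[OF continuous] continuous_intros)
     (auto intro: pos)

lemma flux_deriv: "0 \<le> r \<Longrightarrow> (flux \<beta> has_real_derivative \<beta> r) (at r within {0..})"
  using integral_has_half_line_derivative[OF continuous] by (simp add: flux_def[abs_def])

lemma flux_eq: "0 \<le> r \<Longrightarrow> flux \<beta> r = r * mean r"
  using increment_eq_average[of "flux \<beta>" \<beta> r] flux_deriv by (simp add: flux_def mean_def)

text \<open>The product \<open>r * mean r\<close> is the flux on the half line; its derivative is
  computed once by the product rule and once from the integral.\<close>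

lemma mean_deriv:
  assumes "0 \<le> r" shows "mean r + r * half_line_deriv mean r = \<beta> r"
proof -
  have "((\<lambda>r. r * mean r) has_real_derivative mean r + r * half_line_deriv mean r) (at r within {0..})"
    using smooth_on_half_line_deriv(2)[OF smooth_on_mean assms]
    by (auto intro!: derivative_eq_intros)
  then have "half_line_deriv (\<lambda>r. r * mean r) r = mean r + r * half_line_deriv mean r"
    using assms by (rule half_line_deriv_eq)
  moreover have "((\<lambda>r. r * mean r) has_real_derivative \<beta> r) (at r within {0..})"
    using has_field_derivative_transform_within[OF flux_deriv[OF assms], of 1] assms flux_eq by simp
  then have "half_line_deriv (\<lambda>r. r * mean r) r = \<beta> r"
    using assms by (rule half_line_deriv_eq)
  ultimately show ?thesis by simp
qed

lemma phase_deriv: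
  assumes "0 \<le> r" shows "(phase \<beta> has_real_derivative mean r / 2) (at r within {0..})"
proof -
  have "phase \<beta> = (\<lambda>r. 1/2 * integral {0..r} mean)"
    by (simp add: fun_eq_iff phase_def mean_def[abs_def])
  then show ?thesis
    using integral_has_half_line_derivative[OF smooth_on_imp_continuous_on[OF smooth_on_mean] assms]
    by (auto intro!: derivative_eq_intros)
qed

lemma smooth_on_phase: "smooth_on {0..} (phase \<beta>)"
proof (rule smooth_onI_deriv)
  show "smooth_on {0..} (\<lambda>r. (1/2) * mean r)" by (intro smooth_intros smooth_on_mean)
qed (use phase_deriv in auto)

lemma phase_mono: "0 \<le> r \<Longrightarrow> r \<le> s \<Longrightarrow> phase \<beta> r \<le> phase \<beta> s"
proof (cases "r = s")
  assume rs: "0 \<le> r" "r \<le> s" "r \<noteq> s"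
  have "\<exists>x\<in>{r<..<s}. phase \<beta> s - phase \<beta> r = mean x / 2 * (s - r)"
  proof (rule mvt_simple)
    show "r < s" using rs by simp
    show "(phase \<beta> has_derivative ((*) (mean x / 2))) (at x within {r..s})" if "r \<le> x" "x \<le> s" for x
      using has_field_derivative_subset[OF phase_deriv[of x], of "{r..s}"] that rs
      by (auto simp: has_field_derivative_def)
  qed
  then obtain x where x: "x \<in> {r<..<s}" "phase \<beta> s - phase \<beta> r = mean x / 2 * (s - r)" by blast
  have "0 \<le> mean x / 2 * (s - r)" using mean_pos[of x] rs x(1) by simp
  with x(2) show ?thesis by simp
qed simp

lemma phase_0: "phase \<beta> 0 = 0"
  by (simp add: phase_def)

lemma phase_nonneg: "0 \<le> r \<Longrightarrow> 0 \<le> phase \<beta> r"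
  using phase_mono[of 0 r] phase_0 by simp

lemma phase_pos: "0 < r \<Longrightarrow> 0 < phase \<beta> r"
  using integral_pos_of_continuous[of 0 r mean] mean_pos
    continuous_on_subset[OF smooth_on_imp_continuous_on[OF smooth_on_mean], of "{0..r}"]
  by (simp add: phase_def mean_def[abs_def])

text \<open>Substituting \<open>t\<^sup>2 * r\<close> in the flux gives the antiderivative
  \<open>flux \<beta> (t\<^sup>2 * r) / (2 * r)\<close>. The origin is treated apart because of the
  division by \<open>r\<close>. The result exhibits the potential as a coordinate times a smooth
  function of \<open>\<rho>\<close>.\<close>

lemma radial_alpha_eq: "radial_alpha \<beta> q = mean ((norm q)\<^sup>2 / 2) / 2"
proof (cases "q = 0")
  case True
  then show ?thesis by (simp add: radial_alpha_def magnetic_field_def mean_0)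
next
  case False
  define r where "r = (norm q)\<^sup>2 / 2"
  have r: "0 < r" using False by (simp add: r_def)
  have "((\<lambda>t. t * \<beta> (t\<^sup>2 * r)) has_integral flux \<beta> (1\<^sup>2 * r) / (2 * r) - flux \<beta> (0\<^sup>2 * r) / (2 * r)) {0..1}"
  proof (rule fundamental_theorem_of_calculus)
    fix t :: real assume t: "t \<in> {0..1}"
    have "(\<lambda>t. t\<^sup>2 * r) ` {0..1} \<subseteq> {0..}" using r by auto
    then have "(flux \<beta> has_real_derivative \<beta> (t\<^sup>2 * r)) (at (t\<^sup>2 * r) within (\<lambda>t. t\<^sup>2 * r) ` {0..1})"
      using flux_deriv[of "t\<^sup>2 * r"] r by (auto intro: DERIV_subset)
    then have "(flux \<beta> \<circ> (\<lambda>t. t\<^sup>2 * r) has_real_derivative \<beta> (t\<^sup>2 * r) * (2 * t * r)) (at t within {0..1})"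
      by (rule DERIV_image_chain) (auto intro!: derivative_eq_intros)
    then have "((\<lambda>t. flux \<beta> (t\<^sup>2 * r) / (2 * r)) has_real_derivative \<beta> (t\<^sup>2 * r) * (2 * t * r) / (2 * r)) (at t within {0..1})"
      unfolding o_def by (rule DERIV_cdivide)
    then show "((\<lambda>t. flux \<beta> (t\<^sup>2 * r) / (2 * r)) has_vector_derivative t * \<beta> (t\<^sup>2 * r)) (at t within {0..1})"
      using r by (simp add: has_real_derivative_iff_has_vector_derivative mult.commute)
  qed simp
  then have "integral {0..1} (\<lambda>t. t * \<beta> (t\<^sup>2 * r)) = mean r / 2"
    using r flux_eq[of r] flux_eq[of 0] by (simp add: integral_unique)
  then show ?thesis
    by (simp add: radial_alpha_def magnetic_field_def r_def power_mult_distrib)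
qed

text \<open>Hadamard's lemma writes \<open>f\<close> as \<open>r * k r\<close>; cancelling
  \<open>r\<close> against the flux leaves \<open>k / (2 * mean)\<close>, which is smooth because
  \<open>mean\<close> is positive. In its multiplied form the second conclusion also covers
  \<open>r = 0\<close>, where both sides vanish.\<close>

lemma smooth_ext_quotient:
  assumes "smooth_on {0..} f" "f 0 = 0"
  defines "g \<equiv> smooth_ext (\<lambda>r. f r / (2 * flux \<beta> r))"
  shows "smooth_on {0..} g" and "0 \<le> r \<Longrightarrow> 2 * flux \<beta> r * g r = f r"
proof -
  obtain k where k: "smooth_on {0..} k" "\<And>x. 0 \<le> x \<Longrightarrow> f x = x * k x"
    using smooth_on_factor_ident[OF assms(1,2)] by blast
  have s: "smooth_on {0..} (\<lambda>r. k r * inverse (2 * mean r))"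
    using mean_pos by (intro smooth_intros k(1) smooth_on_mean) (auto simp: less_imp_neq[THEN not_sym])
  have e: "k r * inverse (2 * mean r) = f r / (2 * flux \<beta> r)" if "0 < r" for r
    using that mean_pos[of r] by (simp add: k(2) flux_eq field_simps)
  show "smooth_on {0..} g"
    unfolding g_def by (rule smooth_ext_eqI(1)[OF s e])
  show "2 * flux \<beta> r * g r = f r" if "0 \<le> r"
  proof (cases "r = 0")
    case True then show ?thesis using assms(2) flux_eq[of 0] by simp
  next
    case False
    with that have "0 < r" by simp
    then have "g r = f r / (2 * flux \<beta> r)"
      unfolding g_def using smooth_ext_eqI(2)[OF s, of "\<lambda>r. f r / (2 * flux \<beta> r)" r] e by blast
    then show ?thesis using \<open>0 < r\<close> mean_pos[of r] by (simp add: flux_eq)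
  qed
qed

lemma smooth_on_wkb_F: "smooth_on {0..} (wkb_F \<beta>)"
  and wkb_F_eq: "0 \<le> r \<Longrightarrow> 2 * flux \<beta> r * wkb_F \<beta> r = \<beta> 0 - \<beta> r"
proof -
  have "smooth_on {0..} (\<lambda>r. \<beta> 0 - \<beta> r)" by (intro smooth_intros smooth)
  from smooth_ext_quotient[OF this] show "smooth_on {0..} (wkb_F \<beta>)" 
    "0 \<le> r \<Longrightarrow> 2 * flux \<beta> r * wkb_F \<beta> r = \<beta> 0 - \<beta> r"
    by (simp_all add: wkb_F_def)
qed

section \<open>The amplitudes and their transport equations\<close>

lemma wkb_E_deriv:
  "0 \<le> r \<Longrightarrow> (wkb_E \<beta> has_real_derivative wkb_F \<beta> r * wkb_E \<beta> r) (at r within {0..})"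
  unfolding wkb_E_def[abs_def]
  using integral_has_half_line_derivative[OF smooth_on_imp_continuous_on[OF smooth_on_wkb_F], of r]
  by (auto intro!: derivative_eq_intros)

lemma smooth_on_wkb_E: "smooth_on {0..} (wkb_E \<beta>)"
  unfolding wkb_E_def[abs_def] by (intro smooth_intros smooth_on_integral smooth_on_wkb_F)

lemma wkb_E_pos: "0 < wkb_E \<beta> r"
  by (simp add: wkb_E_def)

definition transport_source :: "nat \<Rightarrow> nat \<Rightarrow> real \<Rightarrow> real" where
  "transport_source m n r =
     (2 * real m + 2) * half_line_deriv (wkb_a \<beta> m n) r
     + 2 * r * half_line_deriv (half_line_deriv (wkb_a \<beta> m n)) r
     + (\<Sum>j\<in>{1..n + 1}. wkb_mu \<beta> m j * wkb_a \<beta> m (n + 1 - j) r)"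

lemma wkb_a_Suc_eq:
  "wkb_a \<beta> m (Suc n) r = wkb_E \<beta> r * integral {0..r} (\<lambda>\<tau>. inverse (wkb_E \<beta> \<tau>) *
     smooth_ext (\<lambda>\<sigma>. transport_source m n \<sigma> / (2 * flux \<beta> \<sigma>)) \<tau>)"
  by (simp add: transport_source_def)

declare wkb_mu.simps(2) [simp del] wkb_a.simps(2) [simp del]

lemma wkb_a_0: "wkb_a \<beta> m n 0 = (if n = 0 then 1 else 0)"
  by (cases n) (simp_all add: wkb_a_Suc_eq wkb_E_def)

text \<open>The solvability condition. At 0 only the amplitude of index 0 survives, with value 1, so
  the sum reduces to \<open>wkb_mu \<beta> m (Suc n)\<close>, which was defined to cancel the
  remaining derivative term.\<close>

lemma transport_source_0: "transport_source m n 0 = 0"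
proof -
  have "(\<Sum>j\<in>{1..n + 1}. wkb_mu \<beta> m j * wkb_a \<beta> m (n + 1 - j) 0)
      = (\<Sum>j\<in>{1..n + 1}. if j = n + 1 then wkb_mu \<beta> m (Suc n) else 0)"
    by (rule sum.cong) (auto simp: wkb_a_0 simp del: wkb_a.simps(1))
  then show ?thesis
    by (simp add: transport_source_def wkb_mu.simps(2) del: sum.cl_ivl_Suc) (simp add: algebra_simps)
qed

lemma smooth_on_wkb_a: "smooth_on {0..} (wkb_a \<beta> m n)"
  and smooth_on_transport_source: "smooth_on {0..} (transport_source m n)"
proof -
  have src: "smooth_on {0..} (transport_source m n)"
    if "\<And>k. k \<le> n \<Longrightarrow> smooth_on {0..} (wkb_a \<beta> m k)" for n
    unfolding transport_source_def[abs_def]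
    by (intro smooth_intros smooth_on_half_line_deriv that) auto
  \<comment> \<open>Strong induction, because the source at level \<open>k\<close> involves all
    amplitudes of index at most \<open>k\<close>.\<close>
  have a: "smooth_on {0..} (wkb_a \<beta> m n)" for n
  proof (induction n rule: less_induct)
    case (less n)
    show ?case
    proof (cases n)
      case 0 then show ?thesis by (simp add: smooth_on_wkb_E)
    next
      case (Suc k)
      have "smooth_on {0..} (smooth_ext (\<lambda>r. transport_source m k r / (2 * flux \<beta> r)))"
        using less Suc by (intro smooth_ext_quotient src transport_source_0) auto
      then have "smooth_on {0..} (\<lambda>r. wkb_a \<beta> m (Suc k) r)"
        unfolding wkb_a_Suc_eq using wkb_E_pos
        by (intro smooth_intros smooth_on_wkb_E smooth_on_integral) (auto simp: less_imp_neq[THEN not_sym])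
      then show ?thesis by (simp add: Suc)
    qed
  qed
  show "smooth_on {0..} (wkb_a \<beta> m n)" by (rule a)
  show "smooth_on {0..} (transport_source m n)" using a by (rule src)
qed

lemma transport_equation_0:
  assumes "0 \<le> r"
  shows "2 * flux \<beta> r * half_line_deriv (wkb_a \<beta> m 0) r = (\<beta> 0 - \<beta> r) * wkb_a \<beta> m 0 r"
proof -
  have "half_line_deriv (wkb_a \<beta> m 0) r = wkb_F \<beta> r * wkb_E \<beta> r"
    using half_line_deriv_eq[OF wkb_E_deriv] assms by simp
  then show ?thesis using wkb_F_eq[OF assms] by (simp flip: mult.assoc)
qed

text \<open>Variation of constants: \<open>wkb_E\<close> solves the homogeneous equation, and the
  integral factor contributes the extended quotient \<open>s\<close>, which multiplied by twice the
  flux gives back the source.\<close>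

lemma transport_equation_Suc:
  assumes "0 \<le> r"
  shows "2 * flux \<beta> r * half_line_deriv (wkb_a \<beta> m (Suc n)) r =
    (\<beta> 0 - \<beta> r) * wkb_a \<beta> m (Suc n) r + transport_source m n r"
proof -
  define s where "s = smooth_ext (\<lambda>\<sigma>. transport_source m n \<sigma> / (2 * flux \<beta> \<sigma>))"
  define k where "k = (\<lambda>\<tau>. inverse (wkb_E \<beta> \<tau>) * s \<tau>)"
  have s: "smooth_on {0..} s" "2 * flux \<beta> r * s r = transport_source m n r"
    unfolding s_def
    by (intro smooth_ext_quotient smooth_on_transport_source transport_source_0 assms)+
  have k: "smooth_on {0..} k"
    unfolding k_def using wkb_E_pos
    by (intro smooth_intros smooth_on_wkb_E s) (auto simp: less_imp_neq[THEN not_sym])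
  have a: "wkb_a \<beta> m (Suc n) = (\<lambda>r. wkb_E \<beta> r * integral {0..r} k)"
    by (simp add: fun_eq_iff wkb_a_Suc_eq k_def s_def)
  have "(wkb_a \<beta> m (Suc n) has_real_derivative wkb_F \<beta> r * wkb_a \<beta> m (Suc n) r + s r)
      (at r within {0..})"
    unfolding a
    using wkb_E_deriv[OF assms] wkb_E_pos[of r]
      integral_has_half_line_derivative[OF smooth_on_imp_continuous_on[OF k] assms]
    by (auto intro!: derivative_eq_intros simp: k_def algebra_simps)
  then have "half_line_deriv (wkb_a \<beta> m (Suc n)) r = wkb_F \<beta> r * wkb_a \<beta> m (Suc n) r + s r"
    using assms by (rule half_line_deriv_eq)
  then show ?thesis
    using wkb_F_eq[OF assms] s(2) by (simp add: distrib_left flip: mult.assoc)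
qed

end

subsection \<open>Partial derivatives and smooth functions of two variables\<close>

lemma partial_eqI: "(u has_derivative u') (at q) \<Longrightarrow> partial k u q = u' (axis k 1)"
  by (simp add: partial_def frechet_derivative_at[symmetric])

lemma partial_const [simp]: "partial k (\<lambda>q. c) = (\<lambda>q. 0)"
  by (rule ext, subst partial_eqI[OF has_derivative_const]) simp

lemma has_derivative_frechet:
  "u differentiable at q \<Longrightarrow> (u has_derivative frechet_derivative u (at q)) (at q)"
  by (simp add: frechet_derivative_works)

lemma partial_add:
  assumes "u differentiable at q" "w differentiable at q"
  shows "partial k (\<lambda>q. u q + w q) q = partial k u q + partial k w q"
  using partial_eqI[OF has_derivative_add[OF assms[THEN has_derivative_frechet]]]
  by (simp add: partial_def)

lemma partial_diff:
  assumes "u differentiable at q" "w differentiable at q"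
  shows "partial k (\<lambda>q. u q - w q) q = partial k u q - partial k w q"
  using partial_eqI[OF has_derivative_diff[OF assms[THEN has_derivative_frechet]]]
  by (simp add: partial_def)

lemma partial_mult:
  assumes "u differentiable at q" "w differentiable at q"
  shows "partial k (\<lambda>q. u q * w q) q = u q * partial k w q + partial k u q * w q"
  using partial_eqI[OF has_derivative_mult[OF assms[THEN has_derivative_frechet]]]
  by (simp add: partial_def)

lemma partial_cnj:
  assumes "u differentiable at q"
  shows "(\<lambda>q. cnj (u q)) differentiable at q" "partial k (\<lambda>q. cnj (u q)) q = cnj (partial k u q)"
proof -
  have "((\<lambda>q. cnj (u q)) has_derivative (\<lambda>x. cnj (frechet_derivative u (at q) x))) (at q)"
    using assms by (intro bounded_linear.has_derivative[OF bounded_linear_cnj])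
       (simp add: frechet_derivative_works)
  then show "(\<lambda>q. cnj (u q)) differentiable at q" "partial k (\<lambda>q. cnj (u q)) q = cnj (partial k u q)"
    by (auto simp: partial_eqI differentiable_def) (simp add: partial_def)
qed

lemma C_k_differentiable: "C_k (Suc n) u \<Longrightarrow> u differentiable at q"
  by (simp add: differentiable_on_def)

lemma C_k_SucD: "C_k (Suc n) u \<Longrightarrow> C_k n u"
proof (induction n arbitrary: u)
  case 0
  then show ?case by (simp add: differentiable_imp_continuous_on)
next
  case (Suc n)
  then show ?case by (metis C_k.simps(2))
qed

lemma C_k_const: "C_k n (\<lambda>q. c)"
  by (induction n arbitrary: c) auto

lemma C_k_add: "C_k n u \<Longrightarrow> C_k n w \<Longrightarrow> C_k n (\<lambda>q. u q + w q)"
proof (induction n arbitrary: u w)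
  case 0 then show ?case by (simp add: continuous_on_add)
next
  case (Suc n)
  have "partial k (\<lambda>q. u q + w q) = (\<lambda>q. partial k u q + partial k w q)" for k
    using Suc.prems C_k_differentiable partial_add by (intro ext) blast
  then show ?case using Suc by (auto simp: differentiable_on_def)
qed

lemma C_k_mult: "C_k n u \<Longrightarrow> C_k n w \<Longrightarrow> C_k n (\<lambda>q. u q * w q)"
proof (induction n arbitrary: u w)
  case 0 then show ?case by (simp add: continuous_on_mult)
next
  case (Suc n)
  have "partial k (\<lambda>q. u q * w q) = (\<lambda>q. u q * partial k w q + partial k u q * w q)" for k
    using Suc.prems C_k_differentiable partial_mult by (intro ext) blast
  moreover have "C_k n (\<lambda>q. u q * partial k w q + partial k u q * w q)" for k
    using Suc.prems C_k_SucD by (intro C_k_add Suc.IH) auto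
  ultimately show ?case using Suc.prems by (auto simp: differentiable_on_def)
qed

lemma C_k_diff: "C_k n u \<Longrightarrow> C_k n w \<Longrightarrow> C_k n (\<lambda>q. u q - w q)"
  using C_k_add[OF _ C_k_mult[OF C_k_const[of n "-1"]], of u w] by simp

lemma C_k_cnj: "C_k n u \<Longrightarrow> C_k n (\<lambda>q. cnj (u q))"
proof (induction n arbitrary: u)
  case 0 then show ?case by (simp add: continuous_on_cnj)
next
  case (Suc n)
  have "partial k (\<lambda>q. cnj (u q)) = (\<lambda>q. cnj (partial k u q))" for k
    using Suc.prems C_k_differentiable partial_cnj by (intro ext) blast
  then show ?case using Suc partial_cnj(1)[of u] by (auto simp: differentiable_on_def)
qed

section \<open>Smooth complex functions on the plane: radial functions and coordinates\<close>

definition C_infty :: "(real^2 \<Rightarrow> complex) \<Rightarrow> bool" where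
  "C_infty u \<longleftrightarrow> (\<forall>n. C_k n u)"

lemma C_infty_differentiable: "C_infty u \<Longrightarrow> u differentiable at q"
  by (auto simp: C_infty_def intro: C_k_differentiable)

lemma C_infty_partial: "C_infty u \<Longrightarrow> C_infty (partial k u)"
  unfolding C_infty_def by (metis C_k.simps(2))

lemma C_infty_continuous: "C_infty u \<Longrightarrow> continuous_on UNIV u"
  unfolding C_infty_def by (metis C_k.simps(1))

lemma C_infty_const: "C_infty (\<lambda>q. c)"
  and C_infty_add: "C_infty u \<Longrightarrow> C_infty w \<Longrightarrow> C_infty (\<lambda>q. u q + w q)"
  and C_infty_diff: "C_infty u \<Longrightarrow> C_infty w \<Longrightarrow> C_infty (\<lambda>q. u q - w q)"
  and C_infty_mult: "C_infty u \<Longrightarrow> C_infty w \<Longrightarrow> C_infty (\<lambda>q. u q * w q)"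
  and C_infty_cnj: "C_infty u \<Longrightarrow> C_infty (\<lambda>q. cnj (u q))"
  by (simp_all add: C_infty_def C_k_const C_k_add C_k_diff C_k_mult C_k_cnj)

lemmas C_infty_intros = C_infty_const C_infty_add C_infty_diff C_infty_mult C_infty_cnj C_infty_partial

definition radial :: "(real \<Rightarrow> real) \<Rightarrow> real^2 \<Rightarrow> complex" where
  "radial f q = of_real (f ((norm q)\<^sup>2 / 2))"

definition coord :: "2 \<Rightarrow> real^2 \<Rightarrow> complex" where
  "coord k q = of_real (q $ k)"

lemma coord_has_derivative: "(coord k has_derivative (\<lambda>x. of_real (x $ k))) (at q)"
  unfolding coord_def[abs_def]
  by (intro bounded_linear_imp_has_derivative bounded_linear_compose[OF bounded_linear_of_real]
        bounded_linear_vec_nth)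

lemma partial_coord: "partial j (coord k) q = (if j = k then 1 else 0)"
  by (simp add: partial_eqI[OF coord_has_derivative] axis_def)

text \<open>The map \<open>(q \<bullet> q) / 2\<close> takes its values in the half line, so the
  chain rule relative to that image works with a one-sided derivative of \<open>f\<close> at 0; the
  gradient of the inner map is \<open>q\<close>.\<close>

lemma radial_has_derivative:
  assumes "\<And>x. 0 \<le> x \<Longrightarrow> (f has_real_derivative f' x) (at x within {0..})"
  shows "(radial f has_derivative (\<lambda>x. of_real (f' ((norm q)\<^sup>2 / 2) * (q \<bullet> x)))) (at q)"
proof -
  have "((\<lambda>q::real^2. (q \<bullet> q) / 2) has_derivative (\<lambda>x. q \<bullet> x)) (at q)"
    by (auto intro!: derivative_eq_intros simp: inner_commute)
  moreover have "(f has_derivative (*) (f' ((q \<bullet> q) / 2))) (at ((q \<bullet> q) / 2) within {0..})"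
    using assms[of "(q \<bullet> q) / 2"] by (simp add: has_field_derivative_def)
  ultimately have "((\<lambda>q. f ((q \<bullet> q) / 2)) has_derivative (\<lambda>x. f' ((q \<bullet> q) / 2) * (q \<bullet> x))) (at q)"
    using has_derivative_in_compose2[of "{0..}" f "\<lambda>r. (*) (f' r)" "\<lambda>q. (q \<bullet> q) / 2" UNIV q "\<lambda>x. q \<bullet> x"]
      assms by (simp add: has_field_derivative_def image_subset_iff)
  from bounded_linear.has_derivative[OF bounded_linear_of_real this]
  show ?thesis by (simp add: radial_def[abs_def] power2_norm_eq_inner)
qed

lemma partial_radial:
  assumes "\<And>x. 0 \<le> x \<Longrightarrow> (f has_real_derivative f' x) (at x within {0..})"
  shows "radial f differentiable at q" "partial k (radial f) q = coord k q * radial f' q"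
  using radial_has_derivative[of f f' q, OF assms]
  by (auto simp: partial_eqI differentiable_def inner_axis coord_def radial_def)

text \<open>The planar analogue of \<open>smooth_closure\<close>: a partial derivative of a radial
  function is a coordinate times a radial function, so the algebra generated by both is stable under
  partial derivatives.\<close>

inductive_set radial_algebra :: "(real^2 \<Rightarrow> complex) set" where
  radial: "smooth_on {0..} f \<Longrightarrow> radial f \<in> radial_algebra"
| const: "(\<lambda>q. c) \<in> radial_algebra"
| coord: "coord k \<in> radial_algebra"
| add: "u \<in> radial_algebra \<Longrightarrow> w \<in> radial_algebra \<Longrightarrow> (\<lambda>q. u q + w q) \<in> radial_algebra"
| mult: "u \<in> radial_algebra \<Longrightarrow> w \<in> radial_algebra \<Longrightarrow> (\<lambda>q. u q * w q) \<in> radial_algebra"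

lemma radial_algebra_partial:
  "u \<in> radial_algebra \<Longrightarrow> (\<forall>q. u differentiable at q) \<and> (\<forall>k. partial k u \<in> radial_algebra)"
proof (induction rule: radial_algebra.induct)
  case (radial f)
  obtain f' where f': "smooth_on {0..} f'"
    "\<And>x. 0 \<le> x \<Longrightarrow> (f has_real_derivative f' x) (at x within {0..})"
    using smooth_on_derivD[OF radial] by auto
  have "partial k (radial f) = (\<lambda>q. coord k q * radial f' q)" for k
    using partial_radial(2)[of f f', OF f'(2)] by auto
  then show ?case using partial_radial(1)[of f f', OF f'(2)] f'(1)
    by (auto intro: radial_algebra.intros)
next
  case (const c)
  then show ?case by (auto intro: radial_algebra.intros)
next
  case (coord k)
  have "partial j (coord k) = (\<lambda>q. if j = k then 1 else 0)" for j
    by (rule ext) (rule partial_coord)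
  then show ?case using coord_has_derivative
    by (auto intro: radial_algebra.const simp: differentiable_def)
next
  case (add u w)
  have "partial k (\<lambda>q. u q + w q) = (\<lambda>q. partial k u q + partial k w q)" for k
    using add.IH partial_add by (intro ext) blast
  then show ?case using add by (auto intro: radial_algebra.add)
next
  case (mult u w)
  have "partial k (\<lambda>q. u q * w q) = (\<lambda>q. u q * partial k w q + partial k u q * w q)" for k
    using mult.IH partial_mult by (intro ext) blast
  then show ?case using mult by (simp add: radial_algebra.add radial_algebra.mult)
qed

lemma radial_algebra_C_infty: "u \<in> radial_algebra \<Longrightarrow> C_infty u"
proof -
  have "C_k n u" if "u \<in> radial_algebra" for n u
    using that
  proof (induction n arbitrary: u)
    case 0
    then show ?case using radial_algebra_partial
      by (auto intro!: differentiable_imp_continuous_on simp: differentiable_on_def)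
  next
    case (Suc n)
    then show ?case using radial_algebra_partial by (auto simp: differentiable_on_def)
  qed
  then show "u \<in> radial_algebra \<Longrightarrow> C_infty u" by (simp add: C_infty_def)
qed

lemma C_infty_radial: "smooth_on {0..} f \<Longrightarrow> C_infty (radial f)"
  by (intro radial_algebra_C_infty radial_algebra.radial)

lemma C_infty_coord: "C_infty (coord k)"
  by (intro radial_algebra_C_infty radial_algebra.coord)

lemma C_infty_power: "C_infty u \<Longrightarrow> C_infty (\<lambda>q. u q ^ n)"
  by (induction n) (auto intro: C_infty_intros)

section \<open>Test functions and the action of the differential expression on them\<close>

lemma test_functions_iff:
  "u \<in> test_functions \<longleftrightarrow> C_infty u \<and> (\<exists>R. \<forall>q. R < norm q \<longrightarrow> u q = 0)"
proof -
  have "compact (closure {q. u q \<noteq> 0}) \<longleftrightarrow> bounded {q. u q \<noteq> 0}"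
    by (auto simp: compact_eq_bounded_closed intro: bounded_subset[OF _ closure_subset])
  also have "\<dots> \<longleftrightarrow> (\<exists>R. \<forall>q. R < norm q \<longrightarrow> u q = 0)"
    unfolding bounded_iff by (auto simp: not_less[symmetric])
  finally show ?thesis by (simp add: test_functions_def C_infty_def)
qed

text \<open>The exterior of a closed ball is open, so \<open>u\<close> is locally zero there;
  differentiation does not enlarge the radius of the support.\<close>

lemma partial_eq_0_outside:
  assumes "\<And>q. R < norm q \<Longrightarrow> u q = 0" "R < norm q"
  shows "partial k u q = 0"
proof -
  have "open (- cball (0::real^2) R)" "q \<in> - cball 0 R" using assms(2) by auto
  then have "(u has_derivative (\<lambda>x. 0)) (at q)"
    by (rule has_derivative_transform_within_open[OF has_derivative_const[of 0]])
       (use assms(1) in auto)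
  then show ?thesis by (simp add: partial_eqI)
qed

lemma test_functions_mult: "u \<in> test_functions \<Longrightarrow> C_infty w \<Longrightarrow> (\<lambda>q. w q * u q) \<in> test_functions"
  by (auto simp: test_functions_iff intro: C_infty_mult)

lemma test_functions_diff:
  "u \<in> test_functions \<Longrightarrow> w \<in> test_functions \<Longrightarrow> (\<lambda>q. u q - w q) \<in> test_functions"
  unfolding test_functions_iff
  by (metis (no_types, lifting) C_infty_diff diff_0_right max_less_iff_conj)

lemma test_functions_add:
  "u \<in> test_functions \<Longrightarrow> w \<in> test_functions \<Longrightarrow> (\<lambda>q. u q + w q) \<in> test_functions"
  unfolding test_functions_iff
  by (metis (no_types, lifting) C_infty_add add_0 max_less_iff_conj)

lemma test_functions_partial: "u \<in> test_functions \<Longrightarrow> partial k u \<in> test_functions"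
  by (metis C_infty_partial partial_eq_0_outside test_functions_iff)

lemma test_functions_momentum:
  assumes "u \<in> test_functions" "C_infty (\<lambda>q. of_real (A q $ k))"
  shows "momentum h A k u \<in> test_functions"
  unfolding momentum_def[abs_def]
  by (intro test_functions_diff test_functions_mult test_functions_partial assms C_infty_const)

lemma test_functions_magnetic:
  assumes "u \<in> test_functions" "\<And>k. C_infty (\<lambda>q. of_real (A q $ k))"
  shows "magnetic_expr h A u \<in> test_functions"
  unfolding magnetic_expr_def[abs_def] sum_2
  by (intro test_functions_add test_functions_momentum assms)

lemma magnetic_expr_diff:
  assumes "C_infty u" "C_infty w" "\<And>k. C_infty (\<lambda>q. of_real (A q $ k))"
  shows "magnetic_expr h A (\<lambda>q. u q - w q) q = magnetic_expr h A u q - magnetic_expr h A w q"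
proof -
  have m: "momentum h A k (\<lambda>q. u q - w q) = (\<lambda>q. momentum h A k u q - momentum h A k w q)"
    if "C_infty u" "C_infty w" for k u w
    using that by (intro ext) (simp add: momentum_def partial_diff C_infty_differentiable algebra_simps)
  have "C_infty (momentum h A k u)" if "C_infty u" for k u
    unfolding momentum_def[abs_def] by (intro C_infty_intros assms that)
  then show ?thesis
    using assms by (simp add: magnetic_expr_def m sum_subtractf)
qed

subsection \<open>Uniqueness of the self-adjoint realization on test functions\<close>

lemma integrable_continuous_compact_support:
  fixes u :: "real^2 \<Rightarrow> 'b::{banach, second_countable_topology}"
  assumes "continuous_on UNIV u" "\<And>q. R < norm q \<Longrightarrow> u q = 0"
  shows "integrable lborel u"
proof -
  have "integrable lborel (\<lambda>q. indicator (cball 0 R) q *\<^sub>R u q)"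
    by (intro borel_integrable_compact continuous_on_subset[OF assms(1)]) auto
  moreover have "(\<lambda>q. indicator (cball 0 R) q *\<^sub>R u q) = u"
    using assms(2) by (auto simp: fun_eq_iff indicator_def not_le)
  ultimately show ?thesis by simp
qed

lemma integrable_test: "u \<in> test_functions \<Longrightarrow> integrable lborel u"
  unfolding test_functions_iff
  by (auto intro: integrable_continuous_compact_support C_infty_continuous)

lemma test_functions_subset_L2: "u \<in> test_functions \<Longrightarrow> u \<in> L2_functions"
proof -
  assume u: "u \<in> test_functions"
  then obtain R where R: "\<And>q. R < norm q \<Longrightarrow> u q = 0" and c: "continuous_on UNIV u"
    by (auto simp: test_functions_iff C_infty_continuous)
  have "u \<in> borel_measurable borel" using c by (rule borel_measurable_continuous_onI)
  moreover have "integrable lborel (\<lambda>q. (cmod (u q))\<^sup>2)"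
    by (rule integrable_continuous_compact_support[of _ R]) (auto intro!: continuous_intros c simp: R)
  ultimately show ?thesis by (simp add: L2_functions_def)
qed

section \<open>Integration by parts and symmetry\<close>

lemma lborel_integral_translation:
  fixes f :: "'a::euclidean_space \<Rightarrow> 'b::{banach, second_countable_topology}"
  assumes "f \<in> borel_measurable borel"
  shows "(\<integral>q. f (c + q) \<partial>lborel) = (\<integral>q. f q \<partial>lborel)"
proof -
  have "(\<integral>q. f q \<partial>lborel) = (\<integral>q. f q \<partial>distr lborel borel ((+) c))"
    by (simp add: lborel_distr_plus)
  also have "\<dots> = (\<integral>q. f (c + q) \<partial>lborel)"
    using assms by (intro integral_distr) auto
  finally show ?thesis by simp
qed

lemma axis_line_has_derivative:
  assumes "u differentiable at (q + t *\<^sub>R axis k 1)"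
  shows "((\<lambda>t. u (q + t *\<^sub>R axis k 1)) has_vector_derivative partial k u (q + t *\<^sub>R axis k 1)) (at t within S)"
proof -
  let ?D = "frechet_derivative u (at (q + t *\<^sub>R axis k 1))"
  have D: "(u has_derivative ?D) (at (q + t *\<^sub>R axis k 1))"
    using assms by (rule has_derivative_frechet)
  have "((\<lambda>t. q + t *\<^sub>R axis k 1) has_derivative (\<lambda>s. s *\<^sub>R axis k 1)) (at t within S)"
    by (auto intro!: derivative_eq_intros)
  from has_derivative_compose[OF this D]
  have "((\<lambda>t. u (q + t *\<^sub>R axis k 1)) has_derivative (\<lambda>s. ?D (s *\<^sub>R axis k 1))) (at t within S)" .
  moreover have "linear ?D" using D by (rule has_derivative_linear)
  ultimately show ?thesis
    by (simp add: has_vector_derivative_def partial_def linear_cmul)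
qed

lemma has_vector_derivative_imp_quotient_tendsto:
  fixes f :: "real \<Rightarrow> 'a::real_normed_vector"
  assumes "(f has_vector_derivative d) (at 0)"
  shows "((\<lambda>t. (f t - f 0) /\<^sub>R t) \<longlongrightarrow> d) (at 0)"
proof -
  have "((\<lambda>t. norm (f t - f 0 - t *\<^sub>R d) / norm t) \<longlongrightarrow> 0) (at 0)"
    using assms by (simp add: has_vector_derivative_def has_derivative_at)
  then have "((\<lambda>t. norm ((f t - f 0) /\<^sub>R t - d)) \<longlongrightarrow> 0) (at 0)"
  proof (rule Lim_transform_eventually)
    have "norm (f t - f 0 - t *\<^sub>R d) / norm t = norm ((f t - f 0) /\<^sub>R t - d)" if "t \<noteq> 0" for t
    proof -
      have "(f t - f 0) /\<^sub>R t - d = (f t - f 0 - t *\<^sub>R d) /\<^sub>R t"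
        using that by (simp add: scaleR_diff_right)
      then show ?thesis by (simp add: divide_inverse mult.commute)
    qed
    then show "\<forall>\<^sub>F t in at 0. norm (f t - f 0 - t *\<^sub>R d) / norm t = norm ((f t - f 0) /\<^sub>R t - d)"
      by (auto simp: eventually_at_filter)
  qed
  then show ?thesis by (rule LIM_zero_cancel[OF tendsto_norm_zero_cancel])
qed

text \<open>The integral of the difference quotient vanishes by translation invariance of Lebesgue
  measure, so Fubini is not needed.\<close>

lemma integral_partial_eq_0:
  assumes "u \<in> test_functions"
  shows "(\<integral>q. partial k u q \<partial>lborel) = 0"
proof -
  obtain R where R: "\<And>q. R < norm q \<Longrightarrow> u q = 0" and u: "C_infty u"
    using assms by (auto simp: test_functions_iff)
  have diff: "u differentiable at q" for q
    using u by (rule C_infty_differentiable)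
  have cont: "continuous_on UNIV u" "continuous_on UNIV (partial k u)"
    using u by (auto intro: C_infty_continuous C_infty_partial)
  then have meas: "u \<in> borel_measurable borel" "partial k u \<in> borel_measurable borel"
    by (auto intro: borel_measurable_continuous_onI)
  define e where "e = (axis k 1 :: real^2)"
  have e: "norm e = 1" by (simp add: e_def)
  obtain M where M: "\<And>q. norm (partial k u q) \<le> M" "0 \<le> M"
  proof -
    have "compact (partial k u ` cball 0 R)"
      by (intro compact_continuous_image continuous_on_subset[OF cont(2)]) auto
    then obtain M where "\<forall>z\<in>partial k u ` cball 0 R. norm z \<le> M"
      using compact_imp_bounded bounded_iff by metis
    then have "norm (partial k u q) \<le> max M 0" for q
      using partial_eq_0_outside[of R u q k] R by (cases "norm q \<le> R") (auto simp: le_max_iff_disj)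
    then show thesis by (rule that) simp
  qed
  define x where "x n = inverse (real (Suc n))" for n
  have x: "0 < x n" "x n \<le> 1" for n by (auto simp: x_def field_simps)
  define s where "s n q = inverse (x n) *\<^sub>R (u (x n *\<^sub>R e + q) - u q)" for n q
  have "(\<lambda>n. \<integral>q. s n q \<partial>lborel) \<longlonglongrightarrow> (\<integral>q. partial k u q \<partial>lborel)"
  proof (rule integral_dominated_convergence)
    \<comment> \<open>The steps \<open>x n\<close> are at most 1, so beyond radius
      \<open>R + 1\<close> both values in the difference quotient vanish; inside, the mean value
      inequality supplies the constant \<open>M\<close>.\<close>
    show "integrable lborel (\<lambda>q::real^2. M * indicator (cball 0 (R + 1)) q :: real)"
      by (intro integrable_mult_right integrable_real_indicator) (use emeasure_bounded_finite[of "cball 0 (R + 1) :: (real^2) set"] in auto)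
    show "AE q in lborel. (\<lambda>n. s n q) \<longlonglongrightarrow> partial k u q"
    proof (rule AE_I2)
      fix q
      have "((\<lambda>t. u (q + t *\<^sub>R e)) has_vector_derivative partial k u q) (at 0)"
        using axis_line_has_derivative[OF diff, where q = q and t = 0 and k = k and S = UNIV] by (simp add: e_def)
      then have "((\<lambda>t. (u (q + t *\<^sub>R e) - u q) /\<^sub>R t) \<longlongrightarrow> partial k u q) (at 0)"
        using has_vector_derivative_imp_quotient_tendsto[of "\<lambda>t. u (q + t *\<^sub>R e)"] by simp
      moreover have "filterlim x (at 0) sequentially"
        unfolding filterlim_at using x(1) LIMSEQ_inverse_real_of_nat
        by (auto simp: x_def[abs_def] less_imp_neq[THEN not_sym])
      ultimately have "(\<lambda>n. (u (q + x n *\<^sub>R e) - u q) /\<^sub>R x n) \<longlonglongrightarrow> partial k u q"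
        by (rule filterlim_compose)
      then show "(\<lambda>n. s n q) \<longlonglongrightarrow> partial k u q" by (simp add: s_def add.commute)
    qed
    show "AE q in lborel. norm (s n q) \<le> M * indicator (cball 0 (R + 1)) q" for n
    proof (rule AE_I2)
      fix q
      show "norm (s n q) \<le> M * indicator (cball 0 (R + 1)) q"
      proof (cases "norm q \<le> R + 1")
        case True
        have "norm ((\<lambda>t. u (q + t *\<^sub>R e)) (x n) - (\<lambda>t. u (q + t *\<^sub>R e)) 0) \<le> M * norm (x n - 0)"
        proof (rule differentiable_bound)
          fix t :: real
          show "((\<lambda>t. u (q + t *\<^sub>R e)) has_derivative (\<lambda>s. s *\<^sub>R partial k u (q + t *\<^sub>R e))) (at t within UNIV)"
            using axis_line_has_derivative[OF diff, where q = q and t = t and k = k and S = UNIV]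
            by (simp add: e_def has_vector_derivative_def)
          show "onorm (\<lambda>s. s *\<^sub>R partial k u (q + t *\<^sub>R e)) \<le> M"
            using M by (intro onorm_le) (simp add: mult.commute[of M] mult_left_mono)
        qed auto
        then have "norm (u (x n *\<^sub>R e + q) - u q) \<le> M * x n" using x(1)[of n] by (simp add: add.commute)
        moreover have "norm (s n q) = norm (u (x n *\<^sub>R e + q) - u q) / x n"
          using x(1)[of n] by (simp add: s_def divide_inverse mult.commute)
        ultimately have "norm (s n q) \<le> M" using x(1)[of n] by (simp add: pos_divide_le_eq)
        then show ?thesis using True by (simp add: indicator_def)
      next
        case False
        have "norm q \<le> norm (x n *\<^sub>R e + q) + norm (x n *\<^sub>R e)"
          using norm_triangle_ineq4[of "x n *\<^sub>R e + q" "x n *\<^sub>R e"] by simp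
        then have "R < norm (x n *\<^sub>R e + q)" using False x[of n] e by simp
        then show ?thesis using False R[of q] R[of "x n *\<^sub>R e + q"] by (simp add: s_def)
      qed
    qed
    have "continuous_on UNIV (s n)" for n
      unfolding s_def[abs_def] by (intro continuous_intros continuous_on_compose2[OF cont(1)]) auto
    then show "s n \<in> borel_measurable lborel" for n
      by (simp add: borel_measurable_continuous_onI)
  qed (use meas in simp)
  moreover have "(\<integral>q. s n q \<partial>lborel) = 0" for n
  proof -
    have iu: "integrable lborel u" using assms by (rule integrable_test)
    have "integrable lborel (\<lambda>q. u (x n *\<^sub>R e + q))"
    proof (rule integrable_continuous_compact_support)
      fix q :: "real^2" assume q: "R + 1 < norm q"
      have "norm q \<le> norm (x n *\<^sub>R e + q) + norm (x n *\<^sub>R e)"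
        using norm_triangle_ineq4[of "x n *\<^sub>R e + q" "x n *\<^sub>R e"] by simp
      then show "u (x n *\<^sub>R e + q) = 0" using q x[of n] e by (intro R) simp
    qed (intro continuous_intros continuous_on_compose2[OF cont(1)], auto)
    then show ?thesis
      unfolding s_def using iu lborel_integral_translation[OF meas(1), of "x n *\<^sub>R e"] by simp
  qed
  ultimately show ?thesis by (simp add: LIMSEQ_const_iff)
qed

text \<open>The potential is real, so its terms cancel, and the two integrands differ by a constant
  multiple of the partial derivative of \<open>f * cnj g\<close>, whose integral is zero.\<close>

lemma momentum_symmetric:
  assumes "f \<in> test_functions" "g \<in> test_functions" "C_infty (\<lambda>q. of_real (A q $ k))"
  shows "(\<integral>q. momentum h A k f q * cnj (g q) \<partial>lborel) = (\<integral>q. f q * cnj (momentum h A k g q) \<partial>lborel)"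
proof -
  have cnj: "(\<lambda>q. cnj (w q)) \<in> test_functions" if "w \<in> test_functions" for w
    using that by (auto simp: test_functions_iff intro: C_infty_cnj)
  have c: "C_infty w" if "w \<in> test_functions" for w using that by (simp add: test_functions_iff)
  have m: "momentum h A k w \<in> test_functions" if "w \<in> test_functions" for w
    using that assms(3) by (rule test_functions_momentum)
  have i1: "integrable lborel (\<lambda>q. momentum h A k f q * cnj (g q))"
    by (intro integrable_test test_functions_mult cnj assms c m)
  have i2: "integrable lborel (\<lambda>q. f q * cnj (momentum h A k g q))"
    by (intro integrable_test test_functions_mult cnj assms c m)
  have fg: "(\<lambda>q. f q * cnj (g q)) \<in> test_functions"
    by (intro test_functions_mult cnj assms c)
  have "momentum h A k f q * cnj (g q) - f q * cnj (momentum h A k g q)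
      = - \<i> * of_real h * partial k (\<lambda>q. f q * cnj (g q)) q" for q
    using assms(1,2)[THEN c, THEN C_infty_differentiable]
    by (simp add: momentum_def partial_mult partial_cnj algebra_simps)
  then have "(\<integral>q. momentum h A k f q * cnj (g q) \<partial>lborel) - (\<integral>q. f q * cnj (momentum h A k g q) \<partial>lborel)
      = (\<integral>q. - \<i> * of_real h * partial k (\<lambda>q. f q * cnj (g q)) q \<partial>lborel)"
    using i1 i2 by (simp flip: Bochner_Integration.integral_diff)
  also have "\<dots> = 0" using integral_partial_eq_0[OF fg] by simp
  finally show ?thesis by simp
qed

lemma magnetic_expr_symmetric:
  assumes "f \<in> test_functions" "g \<in> test_functions" "\<And>k. C_infty (\<lambda>q. of_real (A q $ k))"
  shows "(\<integral>q. magnetic_expr h A f q * cnj (g q) \<partial>lborel) = (\<integral>q. f q * cnj (magnetic_expr h A g q) \<partial>lborel)"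
proof -
  have cnj: "(\<lambda>q. cnj (w q)) \<in> test_functions" if "w \<in> test_functions" for w
    using that by (auto simp: test_functions_iff intro: C_infty_cnj)
  have c: "C_infty w" if "w \<in> test_functions" for w using that by (simp add: test_functions_iff)
  have m: "momentum h A k w \<in> test_functions" if "w \<in> test_functions" for w k
    using that assms(3) by (rule test_functions_momentum)
  have i: "integrable lborel (\<lambda>q. u q * cnj (w q))"
    if "u \<in> test_functions" "w \<in> test_functions" for u w
    by (intro integrable_test test_functions_mult cnj that c)
  have "(\<integral>q. magnetic_expr h A f q * cnj (g q) \<partial>lborel)
      = (\<Sum>k\<in>UNIV. \<integral>q. momentum h A k (momentum h A k f) q * cnj (g q) \<partial>lborel)"
    unfolding magnetic_expr_def sum_distrib_right
    by (rule Bochner_Integration.integral_sum) (intro i m assms)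
  also have "\<dots> = (\<Sum>k\<in>UNIV. \<integral>q. f q * cnj (momentum h A k (momentum h A k g) q) \<partial>lborel)"
    by (intro sum.cong refl) (simp add: momentum_symmetric m assms)
  also have "\<dots> = (\<integral>q. f q * cnj (magnetic_expr h A g q) \<partial>lborel)"
    unfolding magnetic_expr_def cnj_sum sum_distrib_left
    by (rule Bochner_Integration.integral_sum[symmetric]) (intro i m assms)
  finally show ?thesis .
qed

section \<open>The pairing on square integrable functions and closability\<close>

lemma L2_norm_nonneg: "0 \<le> L2_norm u"
  by (simp add: L2_norm_def)

lemma L2_norm_square: "(L2_norm u)\<^sup>2 = (\<integral>q. (cmod (u q))\<^sup>2 \<partial>lborel)"
  by (simp add: L2_norm_def)

lemma L2_integrable_mult:
  assumes "u \<in> L2_functions" "w \<in> L2_functions"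
  shows "integrable lborel (\<lambda>q. cmod (u q) * cmod (w q))"
proof (rule Bochner_Integration.integrable_bound)
  show "integrable lborel (\<lambda>q. (cmod (u q))\<^sup>2 + (cmod (w q))\<^sup>2)"
    using assms by (auto simp: L2_functions_def)
  show "(\<lambda>q. cmod (u q) * cmod (w q)) \<in> borel_measurable lborel"
    using assms by (auto simp: L2_functions_def)
  have "a * b \<le> a\<^sup>2 + b\<^sup>2" if "0 \<le> a" "0 \<le> b" for a b :: real
    using sum_squares_bound[of a b] that mult_nonneg_nonneg[OF that] by linarith
  then show "AE q in lborel. norm (cmod (u q) * cmod (w q)) \<le> norm ((cmod (u q))\<^sup>2 + (cmod (w q))\<^sup>2)"
    by (intro AE_I2) simp
qed

lemma L2_integrable_inner:
  assumes "u \<in> L2_functions" "w \<in> L2_functions"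
  shows "integrable lborel (\<lambda>q. u q * cnj (w q))"
proof (rule Bochner_Integration.integrable_bound[OF L2_integrable_mult[OF assms]])
  have "cnj \<in> borel_measurable borel"
    by (intro borel_measurable_continuous_onI continuous_intros)
  then have "(\<lambda>q. cnj (w q)) \<in> borel_measurable borel"
    using measurable_compose[of w borel borel cnj borel] assms by (auto simp: L2_functions_def)
  then show "(\<lambda>q. u q * cnj (w q)) \<in> borel_measurable lborel"
    using assms by (auto simp: L2_functions_def)
qed (simp add: norm_mult)

lemma L2_functions_diff:
  assumes "u \<in> L2_functions" "w \<in> L2_functions"
  shows "(\<lambda>q. u q - w q) \<in> L2_functions"
proof -
  have "integrable lborel (\<lambda>q. (cmod (u q - w q))\<^sup>2)"
  proof (rule Bochner_Integration.integrable_bound)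
    show "integrable lborel (\<lambda>q. 2 * (cmod (u q))\<^sup>2 + 2 * (cmod (w q))\<^sup>2)"
      using assms by (auto simp: L2_functions_def)
    show "(\<lambda>q. (cmod (u q - w q))\<^sup>2) \<in> borel_measurable lborel"
      using assms by (auto simp: L2_functions_def)
    have "(cmod (a - b))\<^sup>2 \<le> 2 * (cmod a)\<^sup>2 + 2 * (cmod b)\<^sup>2" for a b
    proof -
      have "(cmod (a - b))\<^sup>2 \<le> (cmod a + cmod b)\<^sup>2"
        by (intro power_mono norm_triangle_ineq4) auto
      then show ?thesis using sum_squares_bound[of "cmod a" "cmod b"] by (simp add: power2_sum)
    qed
    then show "AE q in lborel. norm ((cmod (u q - w q))\<^sup>2) \<le> norm (2 * (cmod (u q))\<^sup>2 + 2 * (cmod (w q))\<^sup>2)"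
      by (intro AE_I2) simp
  qed
  then show ?thesis using assms by (auto simp: L2_functions_def)
qed

lemma L2_Cauchy_Schwarz:
  assumes "u \<in> L2_functions" "w \<in> L2_functions"
  shows "cmod (\<integral>q. u q * cnj (w q) \<partial>lborel) \<le> L2_norm u * L2_norm w"
proof -
  define c where "c = (\<integral>q. cmod (u q) * cmod (w q) \<partial>lborel)"
  have iu: "integrable lborel (\<lambda>q. (cmod (u q))\<^sup>2)" and iw: "integrable lborel (\<lambda>q. (cmod (w q))\<^sup>2)"
    using assms by (auto simp: L2_functions_def)
  \<comment> \<open>Weighted inequality between arithmetic and geometric mean, with weights optimal
    when \<open>a\<close> and \<open>b\<close> are the norms. Strictly positive upper bounds are
    used because a norm may be 0; afterwards \<open>e\<close> tends to 0 in
    \<open>L2_norm u + e\<close> and \<open>L2_norm w + e\<close>.\<close>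
  have "c \<le> a * b" if ab: "L2_norm u \<le> a" "L2_norm w \<le> b" "0 < a" "0 < b" for a b
  proof -
    have "c \<le> (\<integral>q. b / (2 * a) * (cmod (u q))\<^sup>2 + a / (2 * b) * (cmod (w q))\<^sup>2 \<partial>lborel)"
      unfolding c_def
    proof (intro integral_mono L2_integrable_mult assms)
      have "x * y \<le> b / (2 * a) * x\<^sup>2 + a / (2 * b) * y\<^sup>2" for x y :: real
      proof -
        have "0 \<le> (b * x - a * y)\<^sup>2 / (2 * a * b)" using ab by simp
        also have "\<dots> = b / (2 * a) * x\<^sup>2 + a / (2 * b) * y\<^sup>2 - x * y"
          using ab by (simp add: field_simps power2_eq_square)
        finally show ?thesis by simp
      qed
      then show "cmod (u q) * cmod (w q) \<le> b / (2 * a) * (cmod (u q))\<^sup>2 + a / (2 * b) * (cmod (w q))\<^sup>2" for q .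
    qed (use iu iw in auto)
    also have "\<dots> = b / (2 * a) * (L2_norm u)\<^sup>2 + a / (2 * b) * (L2_norm w)\<^sup>2"
      using iu iw by (simp add: L2_norm_square)
    also have "\<dots> \<le> b / (2 * a) * a\<^sup>2 + a / (2 * b) * b\<^sup>2"
      using ab by (intro add_mono mult_left_mono power_mono L2_norm_nonneg) auto
    also have "\<dots> = a * b" using ab by (simp add: field_simps power2_eq_square)
    finally show ?thesis .
  qed
  then have "c \<le> (L2_norm u + e) * (L2_norm w + e)" if "0 < e" for e
    using that L2_norm_nonneg[of u] L2_norm_nonneg[of w] by (simp add: add_nonneg_pos)
  moreover have "((\<lambda>e. (L2_norm u + e) * (L2_norm w + e)) \<longlongrightarrow> (L2_norm u + 0) * (L2_norm w + 0)) (at_right 0)"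
    by (intro tendsto_intros)
  ultimately have "c \<le> (L2_norm u + 0) * (L2_norm w + 0)"
    by (intro tendsto_lowerbound[of _ _ "at_right 0"]) (auto simp: eventually_at_right_less eventually_at_filter)
  moreover have "cmod (\<integral>q. u q * cnj (w q) \<partial>lborel) \<le> c"
    using integral_norm_bound[of lborel "\<lambda>q. u q * cnj (w q)"] by (simp add: c_def norm_mult)
  ultimately show ?thesis by simp
qed

text \<open>Closability.  The difference \<open>w\<close> between \<open>v\<close> and the differential expression is orthogonal to
  all test functions by symmetry, and is itself a limit of test functions.\<close>

lemma magnetic_laplacian_unique:
  assumes "u \<in> test_functions" "\<And>k. C_infty (\<lambda>q. of_real (A q $ k))"
    and "(u, v) \<in> magnetic_laplacian h A"
  shows "v \<in> L2_functions" "AE q in lborel. v q = magnetic_expr h A u q"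
proof -
  obtain f where f: "\<And>n. f n \<in> test_functions" "L2_tendsto f u"
    "L2_tendsto (\<lambda>n. magnetic_expr h A (f n)) v"
    using assms(3) by (auto simp: magnetic_laplacian_def)
  show v: "v \<in> L2_functions" using f(3) by (simp add: L2_tendsto_def)
  let ?L = "magnetic_expr h A"
  have C: "C_infty w" if "w \<in> test_functions" for w using that by (simp add: test_functions_iff)
  have Lt: "?L w \<in> test_functions" if "w \<in> test_functions" for w
    using that assms(2) by (rule test_functions_magnetic)
  define w where "w = (\<lambda>q. v q - ?L u q)"
  have w: "w \<in> L2_functions"
    unfolding w_def by (intro L2_functions_diff v test_functions_subset_L2 Lt assms(1))
  \<comment> \<open>Subtracting \<open>u\<close> gives test functions that tend to 0 while their
    images tend to \<open>w\<close>; it remains to see that such a \<open>w\<close>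
    vanishes.\<close>
  define g where "g n = (\<lambda>q. f n q - u q)" for n
  have g: "g n \<in> test_functions" for n
    unfolding g_def by (intro test_functions_diff f assms(1))
  have Lg: "(\<lambda>q. ?L (g n) q - w q) = (\<lambda>q. ?L (f n) q - v q)" for n
    using f(1) assms by (simp add: g_def w_def magnetic_expr_diff C)
  have g0: "(\<lambda>n. L2_norm (g n)) \<longlonglongrightarrow> 0"
    using f(2) by (simp add: L2_tendsto_def g_def)
  have Lgw: "(\<lambda>n. L2_norm (\<lambda>q. ?L (g n) q - w q)) \<longlonglongrightarrow> 0"
    using f(3) by (simp add: Lg L2_tendsto_def)
  have d: "(\<lambda>q. ?L (g n) q - w q) \<in> L2_functions" for n
    by (intro L2_functions_diff w test_functions_subset_L2 Lt g)
  have orth: "(\<integral>q. w q * cnj (t q) \<partial>lborel) = 0" if t: "t \<in> test_functions" for t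
  proof -
    have t2: "t \<in> L2_functions" "?L t \<in> L2_functions" using t Lt test_functions_subset_L2 by auto
    have "cmod (\<integral>q. w q * cnj (t q) \<partial>lborel)
        \<le> L2_norm (g n) * L2_norm (?L t) + L2_norm (\<lambda>q. ?L (g n) q - w q) * L2_norm t" for n
    proof -
      have "(\<integral>q. w q * cnj (t q) \<partial>lborel)
          = (\<integral>q. ?L (g n) q * cnj (t q) \<partial>lborel) - (\<integral>q. (?L (g n) q - w q) * cnj (t q) \<partial>lborel)"
        using L2_integrable_inner[OF test_functions_subset_L2[OF Lt[OF g[of n]]] t2(1)]
          L2_integrable_inner[OF d[of n] t2(1)]
        by (simp add: left_diff_distrib flip: Bochner_Integration.integral_diff)
      \<comment> \<open>Moving the unbounded expression to the fixed \<open>t\<close> makes the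
        convergence of \<open>g n\<close> to 0 sufficient.\<close>
      also have "(\<integral>q. ?L (g n) q * cnj (t q) \<partial>lborel) = (\<integral>q. g n q * cnj (?L t q) \<partial>lborel)"
        by (rule magnetic_expr_symmetric) (intro g t assms(2))+
      finally have "cmod (\<integral>q. w q * cnj (t q) \<partial>lborel)
          \<le> cmod (\<integral>q. g n q * cnj (?L t q) \<partial>lborel) + cmod (\<integral>q. (?L (g n) q - w q) * cnj (t q) \<partial>lborel)"
        using norm_triangle_ineq4 by simp
      also have "\<dots> \<le> L2_norm (g n) * L2_norm (?L t) + L2_norm (\<lambda>q. ?L (g n) q - w q) * L2_norm t"
        by (intro add_mono L2_Cauchy_Schwarz d t2 test_functions_subset_L2 g)
      finally show ?thesis .
    qed
    moreover have "(\<lambda>n. L2_norm (g n) * L2_norm (?L t) + L2_norm (\<lambda>q. ?L (g n) q - w q) * L2_norm t)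
        \<longlonglongrightarrow> 0 * L2_norm (?L t) + 0 * L2_norm t"
      by (intro tendsto_intros g0 Lgw)
    ultimately have "cmod (\<integral>q. w q * cnj (t q) \<partial>lborel) \<le> 0 * L2_norm (?L t) + 0 * L2_norm t"
      by (intro LIMSEQ_le_const) auto
    then show ?thesis by simp
  qed
  \<comment> \<open>Since \<open>w\<close> is orthogonal to \<open>?L (g n)\<close>, pairing
    \<open>w\<close> with itself amounts, up to sign, to pairing it with
    \<open>?L (g n) - w\<close>, whose norm tends to 0.\<close>
  have "(L2_norm w)\<^sup>2 \<le> L2_norm w * L2_norm (\<lambda>q. ?L (g n) q - w q)" for n
  proof -
    have "complex_of_real ((L2_norm w)\<^sup>2) = (\<integral>q. w q * cnj (w q) \<partial>lborel)"
      by (simp add: L2_norm_square complex_norm_square del: of_real_power flip: integral_complex_of_real)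
    also have "\<dots> = (\<integral>q. w q * cnj (?L (g n) q) \<partial>lborel) - (\<integral>q. w q * cnj (?L (g n) q - w q) \<partial>lborel)"
      using L2_integrable_inner[OF w test_functions_subset_L2[OF Lt[OF g[of n]]]]
        L2_integrable_inner[OF w d[of n]]
      by (simp add: right_diff_distrib flip: Bochner_Integration.integral_diff)
    also have "\<dots> = - (\<integral>q. w q * cnj (?L (g n) q - w q) \<partial>lborel)"
      using orth[OF Lt[OF g[of n]]] by simp
    finally have "cmod (complex_of_real ((L2_norm w)\<^sup>2)) = cmod (\<integral>q. w q * cnj (?L (g n) q - w q) \<partial>lborel)"
      by (simp only: norm_minus_cancel)
    also have "\<dots> \<le> L2_norm w * L2_norm (\<lambda>q. ?L (g n) q - w q)"
      by (intro L2_Cauchy_Schwarz w d)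
    finally show ?thesis by (simp only: norm_of_real abs_power2)
  qed
  moreover have "(\<lambda>n. L2_norm w * L2_norm (\<lambda>q. ?L (g n) q - w q)) \<longlonglongrightarrow> L2_norm w * 0"
    by (intro tendsto_intros Lgw)
  ultimately have "(L2_norm w)\<^sup>2 \<le> L2_norm w * 0"
    by (intro LIMSEQ_le_const) auto
  then have "(\<integral>q. (cmod (w q))\<^sup>2 \<partial>lborel) = 0" by (simp flip: L2_norm_square)
  then have "AE q in lborel. (cmod (w q))\<^sup>2 = 0"
    using w by (subst (asm) integral_nonneg_eq_0_iff_AE) (auto simp: L2_functions_def)
  then show "AE q in lborel. v q = ?L u q"
    by eventually_elim (simp add: w_def)
qed

lemma test_functions_in_domain:
  assumes "u \<in> test_functions" "\<And>k. C_infty (\<lambda>q. of_real (A q $ k))"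
  shows "u \<in> Domain (magnetic_laplacian h A)"
proof -
  have "magnetic_expr h A u \<in> test_functions" using assms by (rule test_functions_magnetic)
  then have "(u, magnetic_expr h A u) \<in> magnetic_laplacian h A"
    unfolding magnetic_laplacian_def using assms(1)
    by (auto intro!: exI[of _ "\<lambda>n. u"] test_functions_subset_L2 simp: L2_tendsto_def L2_norm_def)
  then show ?thesis by blast
qed

subsection \<open>The magnetic Laplacian on WKB functions\<close>

definition zcoord :: "real^2 \<Rightarrow> complex" where
  "zcoord q = coord 1 q + \<i> * coord 2 q"

lemma norm_zcoord: "cmod (zcoord q) = norm q"
  by (simp add: zcoord_def coord_def cmod_def norm_vec_def L2_set_def sum_2)

lemma C_infty_zcoord_power: "C_infty (\<lambda>q. zcoord q ^ n)"
  unfolding zcoord_def by (intro C_infty_power C_infty_intros C_infty_coord)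

lemma half_norm_square_nonneg: "0 \<le> (norm (q :: real^2))\<^sup>2 / 2"
  by simp

text \<open>The partial derivatives of \<open>z\<close>. Their squares add up to 0, which is how the
  harmonicity of the powers of \<open>z\<close> enters the computation.\<close>

definition dzcoord :: "2 \<Rightarrow> complex" where
  "dzcoord k = (if k = 1 then 1 else \<i>)"

lemma partial_zcoord_power:
  "partial k (\<lambda>q. zcoord q ^ n) q = of_nat n * zcoord q ^ (n - 1) * dzcoord k"
proof -
  have z: "(zcoord has_derivative (\<lambda>x. complex_of_real (x $ 1) + \<i> * complex_of_real (x $ 2))) (at q)"
    unfolding zcoord_def[abs_def]
    by (intro has_derivative_add has_derivative_mult_right coord_has_derivative)
  have "k = 1 \<or> k = 2" by (rule exhaust_2)
  then show ?thesis
    using partial_eqI[OF has_derivative_power[OF z, of n], of k] by (auto simp: axis_def dzcoord_def)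
qed

lemma partial_uminus:
  assumes "u differentiable at q"
  shows "partial k (\<lambda>q. - u q) q = - partial k u q"
  using partial_diff[OF differentiable_const[of 0] assms, where k = k] by simp

lemma magnetic_expr_expand:
  assumes u: "C_infty u" and A: "\<And>k. C_infty (\<lambda>q. of_real (A q $ k))"
  shows "magnetic_expr h A u q = (\<Sum>k\<in>UNIV. - (of_real h)\<^sup>2 * partial k (partial k u) q
      + \<i> * of_real h * partial k (\<lambda>q. of_real (A q $ k)) q * u q
      + 2 * \<i> * of_real h * of_real (A q $ k) * partial k u q + (of_real (A q $ k))\<^sup>2 * u q)"
proof -
  have "momentum h A k (momentum h A k u) q = - (of_real h)\<^sup>2 * partial k (partial k u) q
      + \<i> * of_real h * partial k (\<lambda>q. of_real (A q $ k)) q * u q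
      + 2 * \<i> * of_real h * of_real (A q $ k) * partial k u q + (of_real (A q $ k))\<^sup>2 * u q" for k
  proof -
    have d: "C_infty (\<lambda>q. (- \<i> * of_real h) * partial k u q)" "C_infty (\<lambda>q. of_real (A q $ k) * u q)"
      by (intro C_infty_intros u A)+
    have "partial k (momentum h A k u) q
        = (- \<i> * of_real h) * partial k (partial k u) q
          - (of_real (A q $ k) * partial k u q + partial k (\<lambda>q. of_real (A q $ k)) q * u q)"
      unfolding momentum_def[abs_def]
      using d[THEN C_infty_differentiable] u A
      by (subst partial_diff)
         (simp_all add: partial_uminus partial_mult C_infty_differentiable C_infty_intros)
    then show ?thesis
      by (simp add: momentum_def[of h A k "momentum h A k u"])
         (simp add: momentum_def power2_eq_square algebra_simps)
  qed
  then show ?thesis by (simp add: magnetic_expr_def)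
qed

lemma coord_squares: "(coord 1 q)\<^sup>2 + (coord 2 q)\<^sup>2 = 2 * radial (\<lambda>r. r) q"
  by (simp add: coord_def radial_def norm_vec_def L2_set_def sum_2 flip: of_real_power of_real_add)

lemma partial_radial_half_line:
  assumes "smooth_on {0..} f"
  shows "partial k (radial f) = (\<lambda>q. coord k q * radial (half_line_deriv f) q)"
  using partial_radial(2)[of f "half_line_deriv f"] smooth_on_half_line_deriv(2)[OF assms] by auto

context wkb_profile
begin

lemma radial_potential_component:
  "complex_of_real (radial_potential \<beta> q $ k) =
    (if k = 1 then - coord 2 q else coord 1 q) * radial (\<lambda>r. mean r / 2) q"
  using exhaust_2[of k]
  by (auto simp: radial_potential_def radial_alpha_eq coord_def radial_def)

lemma smooth_on_half_mean: "smooth_on {0..} (\<lambda>r. mean r / 2)"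
  using smooth_on_intros(5)[OF smooth_on_mean smooth_on_intros(2)[where c = "1/2"]] by simp

lemma C_infty_radial_potential: "C_infty (\<lambda>q. of_real (radial_potential \<beta> q $ k))"
proof -
  have "C_infty (\<lambda>q. (-1) * coord 2 q * radial (\<lambda>r. mean r / 2) q)"
    "C_infty (\<lambda>q. coord 1 q * radial (\<lambda>r. mean r / 2) q)"
    by (intro C_infty_intros C_infty_coord C_infty_radial smooth_on_half_mean)+
  then show ?thesis unfolding radial_potential_component by (cases "k = 1") auto
qed

text \<open>The two components give opposite values, so the radial gauge is divergence free and the
  corresponding term of \<open>magnetic_expr_expand\<close> drops out of the sum.\<close>

lemma partial_radial_potential:
  "partial k (\<lambda>q. of_real (radial_potential \<beta> q $ k)) q =
    (if k = 1 then - 1 else 1) * (coord 1 q * coord 2 q * radial (half_line_deriv (\<lambda>r. mean r / 2)) q)"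
proof -
  let ?M = "radial (\<lambda>r. mean r / 2)"
  have d: "C_infty (coord k)" "C_infty ?M" for k
    by (intro C_infty_coord C_infty_radial smooth_on_half_mean)+
  note pm = partial_radial_half_line[OF smooth_on_half_mean]
  have "partial 1 (\<lambda>q. (- 1) * coord 2 q * ?M q) q
      = - 1 * (coord 1 q * coord 2 q * radial (half_line_deriv (\<lambda>r. mean r / 2)) q)"
    using d[THEN C_infty_differentiable] C_infty_mult[OF C_infty_const[of "-1"] d(1)[of 2], THEN C_infty_differentiable]
    by (simp add: partial_uminus partial_mult partial_coord pm)
  moreover have "partial 2 (\<lambda>q. coord 1 q * ?M q) q
      = coord 1 q * coord 2 q * radial (half_line_deriv (\<lambda>r. mean r / 2)) q"
    using d[THEN C_infty_differentiable] by (simp add: partial_mult partial_coord pm)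
  ultimately show ?thesis
    unfolding radial_potential_component using exhaust_2[of k] by auto
qed

text \<open>The potential is tangential: in the cross term the contributions of \<open>f'\<close>
  cancel, and what is left is the derivative of the power of \<open>z\<close>, which yields the
  angular momentum term by Euler's identity \<open>z * p1 = m * z ^ m\<close>. The same identity
  turns the mixed second derivatives into \<open>2 * m * f'\<close>, and the terms with
  \<open>p2\<close> cancel by harmonicity.\<close>

lemma magnetic_expr_radial:
  fixes h :: real
  assumes f: "smooth_on {0..} f"
  defines "f' \<equiv> half_line_deriv f" and "f'' \<equiv> half_line_deriv (half_line_deriv f)"
  shows "magnetic_expr h (radial_potential \<beta>) (\<lambda>q. zcoord q ^ m * radial f q) q =
    zcoord q ^ m * radial (\<lambda>r. - h\<^sup>2 * (2 * r * f'' r + (2 * real m + 2) * f' r)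
      - h * real m * mean r * f r + r * (mean r)\<^sup>2 / 2 * f r) q"
proof -
  let ?u = "\<lambda>q. zcoord q ^ m * radial f q"
  define p1 where "p1 = of_nat m * zcoord q ^ (m - 1)"
  \<comment> \<open>For \<open>m\<close> equal to 0 or 1 the truncated exponent is harmless, because
    one of the numerical factors is then 0.\<close>
  define p2 where "p2 = of_nat m * (of_nat (m - 1) * zcoord q ^ (m - 1 - 1))"
  have sm: "smooth_on {0..} f" "smooth_on {0..} f'"
    unfolding f'_def by (intro f smooth_on_half_line_deriv)+
  have zp1: "zcoord q * p1 = of_nat m * zcoord q ^ m"
    unfolding p1_def by (cases m) auto
  have Cd: "(\<lambda>q. zcoord q ^ n) differentiable at q" "radial f differentiable at q"
    "radial f' differentiable at q" "coord k differentiable at q" "(\<lambda>q::real^2. c) differentiable at q" for n k q and c :: complex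
    by (intro C_infty_differentiable C_infty_zcoord_power C_infty_radial sm C_infty_coord C_infty_const)+
  have Cd2: "(\<lambda>q. zcoord q ^ m * (coord k q * radial f' q)) differentiable at q"
    "(\<lambda>q. of_nat m * zcoord q ^ n * dzcoord k * radial f q) differentiable at q"
    "(\<lambda>q. of_nat m * zcoord q ^ n * dzcoord k) differentiable at q"
    "(\<lambda>q. of_nat m * zcoord q ^ n) differentiable at q"
    "(\<lambda>q. coord k q * radial f' q) differentiable at q" for k n q
    by (intro C_infty_differentiable C_infty_intros C_infty_zcoord_power C_infty_radial sm C_infty_coord)+
  have pr: "partial k (radial f) = (\<lambda>q. coord k q * radial f' q)"
    "partial k (radial f') = (\<lambda>q. coord k q * radial f'' q)" for k
    using partial_radial_half_line sm by (auto simp: f'_def f''_def)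
  have d1: "partial k ?u = (\<lambda>q. zcoord q ^ m * (coord k q * radial f' q)
      + of_nat m * zcoord q ^ (m - 1) * dzcoord k * radial f q)" for k
    by (rule ext) (simp only: partial_mult Cd partial_zcoord_power pr)
  have d1q: "partial k ?u q = zcoord q ^ m * (coord k q * radial f' q) + p1 * dzcoord k * radial f q" for k
    by (simp add: d1 p1_def)
  have d2: "partial k (partial k ?u) q =
      zcoord q ^ m * ((coord k q)\<^sup>2 * radial f'' q + radial f' q)
      + 2 * p1 * dzcoord k * coord k q * radial f' q + p2 * (dzcoord k)\<^sup>2 * radial f q" for k
    unfolding d1
    by (simp add: partial_add partial_mult Cd Cd2 partial_zcoord_power pr partial_coord p1_def p2_def)
       (simp add: algebra_simps power2_eq_square)
  define x y H where "x = coord 1 q" and "y = coord 2 q" and "H = complex_of_real h"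
  define a where "a = complex_of_real (mean ((norm q)\<^sup>2 / 2)) / 2"
  define F0 F1 F2 where "F0 = radial f q" and "F1 = radial f' q" and "F2 = radial f'' q"
  define Z where "Z = zcoord q ^ m"
  have z: "(x + \<i> * y) * p1 = of_nat m * Z" using zp1 by (simp add: zcoord_def x_def y_def Z_def)
  have r: "x\<^sup>2 + y\<^sup>2 = 2 * radial (\<lambda>r. r) q" by (simp add: coord_squares x_def y_def)
  have a: "radial (\<lambda>r. mean r / 2) q = a" by (simp add: radial_def a_def)
  have "magnetic_expr h (radial_potential \<beta>) ?u q =
     (\<Sum>k\<in>UNIV. - (of_real h)\<^sup>2 * partial k (partial k ?u) q
      + \<i> * of_real h * partial k (\<lambda>q. of_real (radial_potential \<beta> q $ k)) q * ?u q
      + 2 * \<i> * of_real h * of_real (radial_potential \<beta> q $ k) * partial k ?u q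
      + (of_real (radial_potential \<beta> q $ k))\<^sup>2 * ?u q)"
    by (intro magnetic_expr_expand C_infty_mult C_infty_zcoord_power C_infty_radial f
        C_infty_radial_potential)
  also have "\<dots> =
     - H\<^sup>2 * (Z * (x\<^sup>2 * F2 + F1) + 2 * p1 * x * F1 + p2 * F0)
     - H\<^sup>2 * (Z * (y\<^sup>2 * F2 + F1) + 2 * p1 * \<i> * y * F1 - p2 * F0)
     + 2 * \<i> * H * (- y * a) * (Z * (x * F1) + p1 * F0)
     + 2 * \<i> * H * (x * a) * (Z * (y * F1) + p1 * \<i> * F0)
     + (y * a)\<^sup>2 * (Z * F0) + (x * a)\<^sup>2 * (Z * F0)"
    unfolding sum_2 d1q d2 partial_radial_potential
    unfolding radial_potential_component a
    by (simp add: dzcoord_def flip: x_def y_def F0_def F1_def F2_def Z_def H_def)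
  also have "\<dots> = - H\<^sup>2 * (Z * (x\<^sup>2 + y\<^sup>2) * F2 + 2 * Z * F1 + 2 * ((x + \<i> * y) * p1) * F1)
      - 2 * H * a * ((x + \<i> * y) * p1) * F0 + (x\<^sup>2 + y\<^sup>2) * a\<^sup>2 * Z * F0"
    by (simp add: algebra_simps power2_eq_square)
  also have "\<dots> = Z * (- H\<^sup>2 * (2 * radial (\<lambda>r. r) q * F2 + (2 * of_nat m + 2) * F1)
      - 2 * H * a * of_nat m * F0 + 2 * radial (\<lambda>r. r) q * a\<^sup>2 * F0)"
    unfolding z r by (simp add: algebra_simps)
  also have "\<dots> = zcoord q ^ m * radial (\<lambda>r. - h\<^sup>2 * (2 * r * f'' r + (2 * real m + 2) * f' r)
      - h * real m * mean r * f r + r * (mean r)\<^sup>2 / 2 * f r) q"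
    by (simp add: Z_def radial_def H_def a_def F0_def F1_def F2_def power2_eq_square algebra_simps)
  finally show ?thesis .
qed

definition conjugated_expr :: "nat \<Rightarrow> real \<Rightarrow> (real \<Rightarrow> real) \<Rightarrow> real \<Rightarrow> real" where
  "conjugated_expr m h g r = h * (2 * flux \<beta> r * half_line_deriv g r + \<beta> r * g r)
     - h\<^sup>2 * (2 * r * half_line_deriv (half_line_deriv g) r + (2 * real m + 2) * half_line_deriv g r)"

text \<open>The phase solves the eikonal equation: the square of \<open>mean\<close> produced by
  differentiating the exponential twice cancels the squared potential. At order \<open>h\<close> the
  multiples of \<open>m * mean\<close> cancel, and \<open>mean + r * M'\<close> remains, which is
  \<open>\<beta>\<close> by \<open>mean_deriv\<close>; the cross term with \<open>g'\<close> becomes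
  twice the flux.\<close>

lemma magnetic_expr_wkb:
  assumes g: "smooth_on {0..} g" and h: "0 < h"
  shows "magnetic_expr h (radial_potential \<beta>) (\<lambda>q. zcoord q ^ m * radial (\<lambda>r. exp (- phase \<beta> r / h) * g r) q) q =
    zcoord q ^ m * radial (\<lambda>r. exp (- phase \<beta> r / h) * conjugated_expr m h g r) q"
proof -
  define e where "e r = exp (- phase \<beta> r / h)" for r
  define f where "f r = e r * g r" for r
  define g' g'' M' where "g' = half_line_deriv g" and "g'' = half_line_deriv g'"
    and "M' = half_line_deriv mean"
  have gd: "(g has_real_derivative g' r) (at r within {0..})"
    "(g' has_real_derivative g'' r) (at r within {0..})"
    "(mean has_real_derivative M' r) (at r within {0..})" if "0 \<le> r" for r
    using that smooth_on_half_line_deriv[OF g] smooth_on_half_line_deriv(2)[of g' r]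
      smooth_on_half_line_deriv(2)[OF smooth_on_mean]
    by (auto simp: g'_def g''_def M'_def)
  have ed: "(e has_real_derivative - mean r / (2 * h) * e r) (at r within {0..})" if "0 \<le> r" for r
    unfolding e_def[abs_def] using phase_deriv[OF that] h
    by (auto intro!: derivative_eq_intros simp: field_simps)
  have "smooth_on {0..} (\<lambda>r. exp (phase \<beta> r * (- 1 / h)) * g r)"
    by (intro smooth_intros smooth_on_phase g)
  then have f: "smooth_on {0..} f" by (simp add: f_def[abs_def] e_def)
  have f'1: "half_line_deriv f r = e r * (g' r - mean r / (2 * h) * g r)" if "0 \<le> r" for r
    using gd[OF that] ed[OF that] unfolding f_def[abs_def]
    by (intro half_line_deriv_eq that)
       (auto intro!: derivative_eq_intros simp: algebra_simps)
  have "((\<lambda>r. e r * (g' r - mean r / (2 * h) * g r)) has_real_derivative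
      e r * (g'' r - mean r * g' r / h - M' r * g r / (2 * h) + (mean r)\<^sup>2 * g r / (4 * h\<^sup>2))) (at r within {0..})"
    if "0 \<le> r" for r
    using gd[OF that] ed[OF that] h
    by (auto intro!: derivative_eq_intros) (simp add: field_simps power2_eq_square)
  then have f'2: "half_line_deriv (half_line_deriv f) r =
      e r * (g'' r - mean r * g' r / h - M' r * g r / (2 * h) + (mean r)\<^sup>2 * g r / (4 * h\<^sup>2))"
    if "0 \<le> r" for r
    using that f'1 has_field_derivative_transform_within[of _ _ r "{0..}" 1 "half_line_deriv f"]
    by (intro half_line_deriv_eq that) auto
  have eq: "- h\<^sup>2 * (2 * r * half_line_deriv (half_line_deriv f) r + (2 * real m + 2) * half_line_deriv f r)
      - h * real m * mean r * f r + r * (mean r)\<^sup>2 / 2 * f r = e r * conjugated_expr m h g r"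
    if "0 \<le> r" for r
  proof -
    have b: "\<beta> r = mean r + r * M' r" using mean_deriv[OF that] by (simp add: M'_def)
    show ?thesis
      unfolding f'1[OF that] f'2[OF that] f_def conjugated_expr_def flux_eq[OF that] b
        g'_def[symmetric] g''_def[symmetric]
      using h by (simp add: field_simps power2_eq_square)
  qed
  have f_eq: "f = (\<lambda>r. exp (- phase \<beta> r / h) * g r)"
    by (simp add: fun_eq_iff f_def e_def)
  have "radial (\<lambda>r. - h\<^sup>2 * (2 * r * half_line_deriv (half_line_deriv f) r
      + (2 * real m + 2) * half_line_deriv f r)
      - h * real m * mean r * f r + r * (mean r)\<^sup>2 / 2 * f r) q
      = radial (\<lambda>r. exp (- phase \<beta> r / h) * conjugated_expr m h g r) q"
    using eq[OF half_norm_square_nonneg[of q]] by (simp only: radial_def e_def)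
  then show ?thesis
    using magnetic_expr_radial[OF f, of h m q] by (simp only: f_eq)
qed

end

subsection \<open>Residual estimates\<close>

text \<open>Stated with an almost everywhere bound, since an image under the closure is known only
  up to a null set.\<close>

lemma L2_bounded_support:
  assumes "w \<in> borel_measurable borel" "0 \<le> B"
    and "AE q in lborel. cmod (w q) \<le> B * indicator (cball 0 R) q"
  shows "w \<in> L2_functions" "L2_norm w \<le> B * sqrt (measure lborel (cball (0 :: real^2) R))"
proof -
  have fin: "emeasure lborel (cball (0 :: real^2) R) < \<infinity>"
    by (intro emeasure_bounded_finite bounded_cball)
  then have ind: "integrable lborel (\<lambda>q :: real^2. B\<^sup>2 * indicator (cball 0 R) q)"
    by (intro integrable_mult_right integrable_real_indicator) auto
  have le: "AE q in lborel. (cmod (w q))\<^sup>2 \<le> B\<^sup>2 * indicator (cball 0 R) q"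
    using assms(3)
  proof eventually_elim
    case (elim q)
    then have "(cmod (w q))\<^sup>2 \<le> (B * indicator (cball 0 R) q)\<^sup>2"
      by (intro power_mono) auto
    then show ?case by (cases "norm q \<le> R") auto
  qed
  have int: "integrable lborel (\<lambda>q. (cmod (w q))\<^sup>2)"
    by (rule Bochner_Integration.integrable_bound[OF ind]) (use assms(1) le in auto)
  then show "w \<in> L2_functions" using assms(1) by (simp add: L2_functions_def)
  have "(\<integral>q. (cmod (w q))\<^sup>2 \<partial>lborel) \<le> (\<integral>q. B\<^sup>2 * indicator (cball (0 :: real^2) R) q \<partial>lborel)"
    by (intro integral_mono_AE int ind le)
  also have "\<dots> = B\<^sup>2 * measure lborel (cball (0 :: real^2) R)"
    using fin by simp
  finally have "L2_norm w \<le> sqrt (B\<^sup>2 * measure lborel (cball (0 :: real^2) R))"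
    unfolding L2_norm_def by (rule real_sqrt_le_mono)
  then show "L2_norm w \<le> B * sqrt (measure lborel (cball (0 :: real^2) R))"
    using assms(2) by (simp add: real_sqrt_mult)
qed

text \<open>One term of the exponential series is at most \<open>exp x\<close>. This converts
  exponential smallness into any prescribed power of \<open>h\<close>.\<close>

lemma exp_minus_le_fact_div_power:
  fixes x :: real
  assumes "0 < x"
  shows "exp (- x) \<le> fact n / x ^ n"
proof -
  have "x ^ n / fact n \<le> exp x"
  proof -
    have "(\<Sum>k\<in>{n}. x ^ k /\<^sub>R fact k) \<le> (\<Sum>k. x ^ k /\<^sub>R fact k)"
      using assms by (intro sum_le_suminf summable_exp_generic) auto
    then show ?thesis by (simp add: exp_def divide_inverse mult.commute)
  qed
  then show ?thesis using assms by (simp add: exp_minus field_simps)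
qed

text \<open>Agreement on \<open>[0,K)\<close> is agreement on a relative neighbourhood of
  \<open>r\<close> in the half line. It serves to strip the cutoff from derivatives where it equals
  1.\<close>

lemma half_line_deriv_cong:
  assumes "smooth_on {0..} f" "\<And>x. 0 \<le> x \<Longrightarrow> x < K \<Longrightarrow> g x = f x" "0 \<le> r" "r < K"
  shows "half_line_deriv g r = half_line_deriv f r"
proof (intro half_line_deriv_eq assms)
  show "(g has_real_derivative half_line_deriv f r) (at r within {0..})"
    using has_field_derivative_transform_within[OF smooth_on_half_line_deriv(2)[OF assms(1,3)], of "K - r" g] assms
    by (auto simp: dist_real_def)
qed

lemma half_line_deriv_linear_sum:
  assumes "\<And>j. smooth_on {0..} (b j)" "0 \<le> r"
  shows "half_line_deriv (\<lambda>r. \<Sum>j\<in>I. k j * b j r) r = (\<Sum>j\<in>I. k j * half_line_deriv (b j) r)"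
  using smooth_on_half_line_deriv(2)[OF assms(1) assms(2)]
  by (intro half_line_deriv_eq assms(2) DERIV_sum DERIV_cmult)

text \<open>The transport equations cancel every power of \<open>h\<close> up to \<open>h ^ J\<close>.\<close>

lemma transport_telescope:
  fixes h :: real
  assumes T0: "T 0 = \<mu> 0 * a 0"
    and TSuc: "\<And>n. T (Suc n) = N n + (\<Sum>j\<le>Suc n. \<mu> j * a (Suc n - j))"
  shows "(\<Sum>n\<le>J. h ^ n * T n) - h * (\<Sum>n\<le>J. h ^ n * N n) - (\<Sum>k\<le>J. \<mu> k * h ^ k) * (\<Sum>j\<le>J. h ^ j * a j)
    = - (h ^ Suc J * N J) - (\<Sum>(k, j)\<in>{..J} \<times> {..J} \<inter> {(k, j). J < k + j}. \<mu> k * a j * h ^ (k + j))"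
proof -
  \<comment> \<open>The \<open>N n\<close> inside \<open>T (Suc n)\<close> pairs with the term
    \<open>h * h ^ n * N n\<close>; only \<open>N J\<close>, whose partner would be
    \<open>T (Suc J)\<close>, stays unmatched.\<close>
  have T: "(\<Sum>n\<le>J. h ^ n * T n) + h ^ Suc J * N J
      = h * (\<Sum>n\<le>J. h ^ n * N n) + (\<Sum>n\<le>J. \<Sum>j\<le>n. \<mu> j * a (n - j) * h ^ n)"
  proof (induction J)
    case 0 show ?case by (simp add: T0)
  next
    case (Suc J)
    have "h ^ Suc J * T (Suc J) = h ^ Suc J * N J + (\<Sum>j\<le>Suc J. \<mu> j * a (Suc J - j) * h ^ Suc J)"
      unfolding TSuc by (simp only: distrib_left sum_distrib_left mult_ac)
    then show ?case using Suc.IH by (simp add: algebra_simps del: sum.atMost_Suc)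
        (simp add: algebra_simps)
  qed
  let ?f = "\<lambda>(k, j). \<mu> k * a j * h ^ (k + j)"
  have "(\<Sum>k\<le>J. \<mu> k * h ^ k) * (\<Sum>j\<le>J. h ^ j * a j) = (\<Sum>p\<in>{..J} \<times> {..J}. ?f p)"
    unfolding sum_product sum.cartesian_product by (rule sum.cong) (auto simp: power_add)
  \<comment> \<open>Of the square of indices, the triangle with \<open>k + j \<le> J\<close> is the
    Cauchy product already produced by \<open>T\<close>; the rest has order at least
    \<open>J + 1\<close>.\<close>
  also have "\<dots> = (\<Sum>p\<in>{..J} \<times> {..J} \<inter> {(k, j). J < k + j}. ?f p)
      + (\<Sum>p\<in>{..J} \<times> {..J} - {(k, j). J < k + j}. ?f p)"
    by (rule sum.Int_Diff) auto
  also have "{..J} \<times> {..J} - {(k, j). J < k + j} = {(k, j). k + j \<le> J}" by auto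
  also have "(\<Sum>p\<in>{(k, j). k + j \<le> J}. ?f p) = (\<Sum>n\<le>J. \<Sum>j\<le>n. \<mu> j * a (n - j) * h ^ n)"
    unfolding sum.triangle_reindex_eq by (intro sum.cong) auto
  finally show ?thesis using T by simp
qed

lemma transport_telescope_bound:
  fixes h :: real
  assumes T0: "T 0 = \<mu> 0 * a 0"
    and TSuc: "\<And>n. T (Suc n) = N n + (\<Sum>j\<le>Suc n. \<mu> j * a (Suc n - j))"
    and h: "0 < h" "h < 1"
  shows "\<bar>(\<Sum>n\<le>J. h ^ n * T n) - h * (\<Sum>n\<le>J. h ^ n * N n) - (\<Sum>k\<le>J. \<mu> k * h ^ k) * (\<Sum>j\<le>J. h ^ j * a j)\<bar>
    \<le> h ^ Suc J * (\<bar>N J\<bar> + (\<Sum>k\<le>J. \<bar>\<mu> k\<bar>) * (\<Sum>j\<le>J. \<bar>a j\<bar>))"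
proof -
  let ?P = "{..J} \<times> {..J} \<inter> {(k, j). J < k + j}"
  have "\<bar>\<Sum>(k, j)\<in>?P. \<mu> k * a j * h ^ (k + j)\<bar> \<le> (\<Sum>(k, j)\<in>?P. \<bar>\<mu> k\<bar> * \<bar>a j\<bar> * h ^ Suc J)"
  proof (rule order_trans[OF sum_abs sum_mono])
    fix p assume "p \<in> ?P"
    then obtain k j where p: "p = (k, j)" "Suc J \<le> k + j" by auto
    have "h ^ (k + j) \<le> h ^ Suc J" using p h by (intro power_decreasing) auto
    then show "\<bar>case p of (k, j) \<Rightarrow> \<mu> k * a j * h ^ (k + j)\<bar> \<le> (case p of (k, j) \<Rightarrow> \<bar>\<mu> k\<bar> * \<bar>a j\<bar> * h ^ Suc J)"
      using p h by (simp add: abs_mult mult_left_mono del: power_Suc)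
  qed
  also have "\<dots> \<le> (\<Sum>(k, j)\<in>{..J} \<times> {..J}. \<bar>\<mu> k\<bar> * \<bar>a j\<bar> * h ^ Suc J)"
    using h by (intro sum_mono2) auto
  also have "\<dots> = h ^ Suc J * ((\<Sum>k\<le>J. \<bar>\<mu> k\<bar>) * (\<Sum>j\<le>J. \<bar>a j\<bar>))"
    unfolding sum_product sum.cartesian_product
    unfolding sum_distrib_left by (rule sum.cong) auto
  finally have "\<bar>\<Sum>(k, j)\<in>?P. \<mu> k * a j * h ^ (k + j)\<bar> \<le> h ^ Suc J * ((\<Sum>k\<le>J. \<bar>\<mu> k\<bar>) * (\<Sum>j\<le>J. \<bar>a j\<bar>))" .
  moreover have "\<bar>h ^ Suc J * N J\<bar> = h ^ Suc J * \<bar>N J\<bar>" using h by (simp add: abs_mult)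
  ultimately show ?thesis
    unfolding transport_telescope[of T \<mu> a N, OF T0 TSuc] distrib_left by linarith
qed

lemma crude_expansion_bound:
  fixes h :: real
  assumes h: "0 < h" "h < 1"
  shows "\<bar>(\<Sum>n\<le>J. h ^ n * T n) - h * (\<Sum>n\<le>J. h ^ n * N n) - (\<Sum>k\<le>J. \<mu> k * h ^ k) * (\<Sum>j\<le>J. h ^ j * a j)\<bar>
    \<le> (\<Sum>n\<le>J. \<bar>T n\<bar>) + (\<Sum>n\<le>J. \<bar>N n\<bar>) + (\<Sum>k\<le>J. \<bar>\<mu> k\<bar>) * (\<Sum>j\<le>J. \<bar>a j\<bar>)"
proof -
  have pw: "\<bar>\<Sum>n\<le>J. h ^ n * F n\<bar> \<le> (\<Sum>n\<le>J. \<bar>F n\<bar>)" for F :: "nat \<Rightarrow> real"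
  proof (rule order_trans[OF sum_abs sum_mono])
    fix n
    have "h ^ n \<le> 1" using h by (intro power_le_one) auto
    then show "\<bar>h ^ n * F n\<bar> \<le> \<bar>F n\<bar>"
      using h mult_right_mono[of "h ^ n" 1 "\<bar>F n\<bar>"] by (simp add: abs_mult)
  qed
  have "\<bar>h * (\<Sum>n\<le>J. h ^ n * N n)\<bar> \<le> 1 * (\<Sum>n\<le>J. \<bar>N n\<bar>)"
    unfolding abs_mult using h by (intro mult_mono pw) auto
  moreover have "\<bar>(\<Sum>k\<le>J. \<mu> k * h ^ k) * (\<Sum>j\<le>J. h ^ j * a j)\<bar> \<le> (\<Sum>k\<le>J. \<bar>\<mu> k\<bar>) * (\<Sum>j\<le>J. \<bar>a j\<bar>)"
    unfolding abs_mult using pw[of \<mu>]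
    by (intro mult_mono pw) (auto simp: mult.commute intro: sum_nonneg)
  ultimately show ?thesis using pw[of T] by linarith
qed

lemma momentum_eq_0_outside:
  assumes "\<And>q. R < norm q \<Longrightarrow> u q = 0" "R < norm q"
  shows "momentum h A k u q = 0"
  using assms partial_eq_0_outside[of R u q k] by (simp add: momentum_def)

lemma magnetic_expr_eq_0_outside:
  assumes "\<And>q. R < norm q \<Longrightarrow> u q = 0" "R < norm q"
  shows "magnetic_expr h A u q = 0"
  unfolding magnetic_expr_def
  by (intro sum.neutral ballI momentum_eq_0_outside[of R] assms)

text \<open>Polar form of \<open>z\<close>; the constant comes from the 2 in \<open>\<rho>\<close>.
  At the origin both sides are 0 for positive \<open>m\<close> and 1 for \<open>m = 0\<close>. This
  shows that the jump of the angle is only apparent in the quasimode.\<close>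

lemma polar_factor:
  "exp (\<i> * of_nat m * of_real (polar_angle q)) * of_real (sqrt ((norm q)\<^sup>2 / 2) ^ m)
    = of_real ((1 / sqrt 2) ^ m) * zcoord q ^ m"
proof (cases "zcoord q = 0")
  case True
  then have "q = 0" using norm_zcoord[of q] by simp
  with True show ?thesis by (cases m) auto
next
  case False
  have z: "Complex (q $ 1) (q $ 2) = zcoord q"
    by (simp add: zcoord_def coord_def complex_eq_iff)
  have "zcoord q = of_real (norm q) * exp (\<i> * of_real (polar_angle q))"
    using Arg_eq[OF False] by (simp add: polar_angle_def z norm_zcoord)
  then have "zcoord q ^ m = of_real (norm q) ^ m * exp (\<i> * of_nat m * of_real (polar_angle q))"
    by (metis (no_types, lifting) exp_of_nat_mult mult.assoc mult.left_commute power_mult_distrib)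
  then show ?thesis
    by (simp add: real_sqrt_divide power_divide)
qed

section \<open>The quasimode with cutoff and its residual\<close>

locale wkb_cutoff = wkb_profile +
  fixes chi :: "real \<Rightarrow> real" and K :: real and m J :: nat
  assumes K: "0 < K"
    and chi: "smooth_on {0..} chi"
    and chi_1: "\<And>r. 0 \<le> r \<Longrightarrow> r \<le> K \<Longrightarrow> chi r = 1"
    and chi_0: "\<And>r. K + 1 \<le> r \<Longrightarrow> chi r = 0"
begin

abbreviation "mu \<equiv> wkb_mu \<beta> m"

text \<open>Cutoff and normalising constant are absorbed into the amplitude, so that
  \<open>magnetic_expr_wkb\<close> applies to the whole quasimode without separate commutator
  terms.\<close>

definition amp :: "nat \<Rightarrow> real \<Rightarrow> real" where
  "amp j r = (1 / sqrt 2) ^ m * chi r * wkb_a \<beta> m j r"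

definition amp_sum :: "real \<Rightarrow> real \<Rightarrow> real" where
  "amp_sum h r = (\<Sum>j\<le>J. h ^ j * amp j r)"

definition "transport_part j r = 2 * flux \<beta> r * half_line_deriv (amp j) r + \<beta> r * amp j r"

definition "radial_laplacian_part j r = 2 * r * half_line_deriv (half_line_deriv (amp j)) r
  + (2 * real m + 2) * half_line_deriv (amp j) r"

definition residual :: "real \<Rightarrow> real \<Rightarrow> real" where
  "residual h r = conjugated_expr m h (amp_sum h) r - wkb_eigenvalue \<beta> m J h * amp_sum h r"

text \<open>Free of \<open>h\<close>, and large enough to serve both the crude estimate and, after
  the factor \<open>h ^ (J + 2)\<close>, the fine one.\<close>

definition majorant :: "real \<Rightarrow> real" where
  "majorant r = (\<Sum>n\<le>J. \<bar>transport_part n r\<bar>) + (\<Sum>n\<le>J. \<bar>radial_laplacian_part n r\<bar>) + (\<Sum>k\<le>J. \<bar>mu k\<bar>) * (\<Sum>j\<le>J. \<bar>amp j r\<bar>)"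

abbreviation "quasimode \<equiv> wkb_quasimode \<beta> chi m J"

lemma smooth_on_amp: "smooth_on {0..} (amp j)"
  unfolding amp_def[abs_def] by (intro smooth_intros chi smooth_on_wkb_a)

lemma smooth_on_amp_sum: "smooth_on {0..} (amp_sum h)"
  unfolding amp_sum_def[abs_def] by (intro smooth_intros smooth_on_amp)

text \<open>Linearity in the amplitudes. The factor \<open>h\<close> in front is the one that raises
  the order from \<open>J + 1\<close> to \<open>J + 2\<close>.\<close>

lemma residual_eq:
  assumes "0 \<le> r"
  shows "residual h r = h * ((\<Sum>n\<le>J. h ^ n * transport_part n r) - h * (\<Sum>n\<le>J. h ^ n * radial_laplacian_part n r)
    - (\<Sum>k\<le>J. mu k * h ^ k) * (\<Sum>j\<le>J. h ^ j * amp j r))"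
proof -
  have d1: "half_line_deriv (amp_sum h) r = (\<Sum>j\<le>J. h ^ j * half_line_deriv (amp j) r)" if "0 \<le> r" for r
    unfolding amp_sum_def[abs_def] by (intro half_line_deriv_linear_sum smooth_on_amp that)
  have "half_line_deriv (half_line_deriv (amp_sum h)) r
      = half_line_deriv (\<lambda>r. \<Sum>j\<le>J. h ^ j * half_line_deriv (amp j) r) r"
    using assms d1
    by (intro half_line_deriv_cong[of _ "r + 1"] smooth_intros smooth_on_half_line_deriv smooth_on_amp) auto
  also have "\<dots> = (\<Sum>j\<le>J. h ^ j * half_line_deriv (half_line_deriv (amp j)) r)"
    by (intro half_line_deriv_linear_sum smooth_on_half_line_deriv smooth_on_amp assms)
  finally have d2: "half_line_deriv (half_line_deriv (amp_sum h)) r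
      = (\<Sum>j\<le>J. h ^ j * half_line_deriv (half_line_deriv (amp j)) r)" .
  have l1: "(\<Sum>n\<le>J. h ^ n * transport_part n r)
      = 2 * flux \<beta> r * (\<Sum>j\<le>J. h ^ j * half_line_deriv (amp j) r) + \<beta> r * (\<Sum>j\<le>J. h ^ j * amp j r)"
    unfolding transport_part_def distrib_left sum.distrib sum_distrib_left by (simp add: mult_ac)
  have l2: "(\<Sum>n\<le>J. h ^ n * radial_laplacian_part n r)
      = 2 * r * (\<Sum>j\<le>J. h ^ j * half_line_deriv (half_line_deriv (amp j)) r)
        + (2 * real m + 2) * (\<Sum>j\<le>J. h ^ j * half_line_deriv (amp j) r)"
    unfolding radial_laplacian_part_def distrib_left[of "h ^ _"] sum.distrib sum_distrib_left by (simp add: mult_ac)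
  show ?thesis
    unfolding residual_def conjugated_expr_def wkb_eigenvalue_def d1[OF assms] d2 l1 l2 amp_sum_def
    by (simp add: atMost_atLeast0 algebra_simps power2_eq_square)
qed

lemma majorant_bound: obtains M where "0 \<le> M" "\<And>r. 0 \<le> r \<Longrightarrow> r \<le> K + 1 \<Longrightarrow> majorant r \<le> M"
proof -
  have c: "continuous_on {0..K + 1} f" if "smooth_on {0..} f" for f
    by (rule continuous_on_subset[OF smooth_on_imp_continuous_on[OF that]]) auto
  have fl: "smooth_on {0..} (flux \<beta>)"
    unfolding flux_def[abs_def] by (rule smooth_on_integral[OF smooth])
  have "continuous_on {0..K + 1} majorant"
    unfolding majorant_def[abs_def] transport_part_def radial_laplacian_part_def
    by (intro continuous_intros c smooth_on_amp smooth_on_half_line_deriv fl smooth)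
  then have "compact (majorant ` {0..K + 1})" by (intro compact_continuous_image) auto
  then obtain M where "\<forall>z\<in>majorant ` {0..K + 1}. norm z \<le> M"
    using compact_imp_bounded bounded_iff by metis
  then show thesis by (intro that[of "max M 0"]) (auto simp: abs_le_iff le_max_iff_disj)
qed

lemma residual_crude:
  assumes "0 \<le> r" "0 < h" "h < 1"
  shows "\<bar>residual h r\<bar> \<le> majorant r"
proof -
  have "\<bar>residual h r\<bar> \<le> 1 * majorant r"
    unfolding residual_eq[OF assms(1)] abs_mult majorant_def
    using assms by (intro mult_mono crude_expansion_bound) auto
  then show ?thesis by simp
qed

text \<open>For \<open>r < K\<close> the cutoff equals 1 on a neighbourhood within the half line, so
  \<open>amp j\<close> and its first two derivatives are a fixed multiple of those of
  \<open>wkb_a \<beta> m j\<close>, and the transport equations carry over.\<close>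

lemma residual_fine:
  assumes r: "0 \<le> r" "r < K" and h: "0 < h" "h < 1"
  shows "\<bar>residual h r\<bar> \<le> h ^ (J + 2) * majorant r"
proof -
  define c where "c = (1 / sqrt 2 :: real) ^ m"
  have sa: "smooth_on {0..} (\<lambda>r. c * wkb_a \<beta> m j r)" "smooth_on {0..} (\<lambda>r. c * half_line_deriv (wkb_a \<beta> m j) r)" for j
    by (intro smooth_intros smooth_on_wkb_a smooth_on_half_line_deriv)+
  have lin: "half_line_deriv (\<lambda>r. c * f r) r = c * half_line_deriv f r"
    if "smooth_on {0..} f" "0 \<le> r" for f r
    using smooth_on_half_line_deriv(2)[OF that] by (intro half_line_deriv_eq that DERIV_cmult)
  have a0: "amp j r = c * wkb_a \<beta> m j r" if "0 \<le> r" "r < K" for j r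
    using that chi_1[of r] by (simp add: amp_def c_def)
  have a1: "half_line_deriv (amp j) r = c * half_line_deriv (wkb_a \<beta> m j) r" if "0 \<le> r" "r < K" for j r
    using half_line_deriv_cong[OF sa(1) a0 that] lin[OF smooth_on_wkb_a that(1)] by simp
  have a2: "half_line_deriv (half_line_deriv (amp j)) r = c * half_line_deriv (half_line_deriv (wkb_a \<beta> m j)) r"
    if "0 \<le> r" "r < K" for j r
    using half_line_deriv_cong[OF sa(2) a1 that]
      lin[OF smooth_on_half_line_deriv(1)[OF smooth_on_wkb_a] that(1)] by simp
  have l1: "transport_part j r = c * (2 * flux \<beta> r * half_line_deriv (wkb_a \<beta> m j) r + \<beta> r * wkb_a \<beta> m j r)" for j
    by (simp add: transport_part_def a0[OF r] a1[OF r] algebra_simps)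
  have T0: "transport_part 0 r = mu 0 * amp 0 r"
    unfolding l1 transport_equation_0[OF r(1)] a0[OF r] by (simp add: algebra_simps)
  have TSuc: "transport_part (Suc n) r = radial_laplacian_part n r + (\<Sum>j\<le>Suc n. mu j * amp (Suc n - j) r)" for n
  proof -
    have "(\<Sum>j\<le>Suc n. mu j * amp (Suc n - j) r) = c * (\<Sum>j\<le>Suc n. mu j * wkb_a \<beta> m (Suc n - j) r)"
      by (simp only: a0[OF r] sum_distrib_left mult_ac)
    \<comment> \<open>The term \<open>j = 0\<close> is split off: with
      \<open>mu 0 = \<beta> 0\<close> it matches the term in \<open>\<beta> 0\<close> of the
      transport equation, while the others sit in the source.\<close>
    also have "(\<Sum>j\<le>Suc n. mu j * wkb_a \<beta> m (Suc n - j) r)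
        = \<beta> 0 * wkb_a \<beta> m (Suc n) r + (\<Sum>j\<in>{1..n + 1}. mu j * wkb_a \<beta> m (n + 1 - j) r)"
    proof -
      have "{..Suc n} = insert 0 {1..n + 1}" by auto
      then show ?thesis by simp
    qed
    finally show ?thesis
      unfolding l1 transport_equation_Suc[OF r(1)] radial_laplacian_part_def a1[OF r] a2[OF r] transport_source_def
      by (simp add: algebra_simps)
  qed
  have "\<bar>residual h r\<bar> \<le> h * (h ^ Suc J * (\<bar>radial_laplacian_part J r\<bar> + (\<Sum>k\<le>J. \<bar>mu k\<bar>) * (\<Sum>j\<le>J. \<bar>amp j r\<bar>)))"
    unfolding residual_eq[OF r(1)] abs_mult
    using h transport_telescope_bound[of "\<lambda>n. transport_part n r" mu "\<lambda>n. amp n r" "\<lambda>n. radial_laplacian_part n r" h J, OF T0 TSuc h]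
    by (intro mult_mono) auto
  also have "\<dots> \<le> h * (h ^ Suc J * majorant r)"
  proof -
    have "\<bar>radial_laplacian_part J r\<bar> \<le> (\<Sum>n\<le>J. \<bar>radial_laplacian_part n r\<bar>)" by (rule member_le_sum) auto
    moreover have "0 \<le> (\<Sum>n\<le>J. \<bar>transport_part n r\<bar>)" by (simp add: sum_nonneg)
    ultimately have "\<bar>radial_laplacian_part J r\<bar> + (\<Sum>k\<le>J. \<bar>mu k\<bar>) * (\<Sum>j\<le>J. \<bar>amp j r\<bar>) \<le> majorant r"
      unfolding majorant_def by linarith
    then show ?thesis using h by (intro mult_left_mono) auto
  qed
  finally show ?thesis by (simp add: mult_ac)
qed

lemma quasimode_eq:
  "quasimode h = (\<lambda>q. zcoord q ^ m * radial (\<lambda>r. exp (- phase \<beta> r / h) * amp_sum h r) q)"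
proof
  fix q :: "real^2"
  let ?r = "(norm q)\<^sup>2 / 2"
  have "amp_sum h ?r = (1 / sqrt 2) ^ m * chi ?r * (\<Sum>j\<in>{0..J}. wkb_a \<beta> m j ?r * h ^ j)"
    by (simp add: amp_sum_def amp_def sum_distrib_left atMost_atLeast0 mult_ac)
  moreover have "quasimode h q = (exp (\<i> * of_nat m * of_real (polar_angle q)) * of_real (sqrt ?r ^ m))
      * of_real (exp (- phase \<beta> ?r / h) * (chi ?r * (\<Sum>j\<in>{0..J}. wkb_a \<beta> m j ?r * h ^ j)))"
    by (simp add: wkb_quasimode_def wkb_weight_def mult_ac)
  ultimately show "quasimode h q = zcoord q ^ m * radial (\<lambda>r. exp (- phase \<beta> r / h) * amp_sum h r) q"
    unfolding polar_factor radial_def by (simp add: mult_ac)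
qed

lemma quasimode_support: "sqrt (2 * (K + 1)) < norm q \<Longrightarrow> quasimode h q = 0"
proof -
  assume "sqrt (2 * (K + 1)) < norm q"
  then have "2 * (K + 1) < (norm q)\<^sup>2" by (meson not_le real_le_rsqrt)
  then show ?thesis using chi_0[of "(norm q)\<^sup>2 / 2"] by (simp add: wkb_quasimode_def)
qed

lemma quasimode_test: "quasimode h \<in> test_functions"
proof -
  have "smooth_on {0..} (\<lambda>r. exp (phase \<beta> r * (- 1 / h)) * amp_sum h r)"
    by (intro smooth_intros smooth_on_phase smooth_on_amp_sum)
  then have "C_infty (quasimode h)"
    unfolding quasimode_eq by (intro C_infty_mult C_infty_zcoord_power C_infty_radial) simp
  then show ?thesis using quasimode_support by (auto simp: test_functions_iff)
qed

lemma quasimode_residual: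
  assumes "0 < h"
  shows "magnetic_expr h (radial_potential \<beta>) (quasimode h) q - of_real (wkb_eigenvalue \<beta> m J h) * quasimode h q
    = zcoord q ^ m * radial (\<lambda>r. exp (- phase \<beta> r / h) * residual h r) q"
  unfolding quasimode_eq magnetic_expr_wkb[OF smooth_on_amp_sum assms]
  by (simp add: radial_def residual_def algebra_simps)

lemma weighted_residual_bound:
  assumes \<epsilon>: "0 < \<epsilon>" "\<epsilon> < 1"
  obtains C where "0 \<le> C"
    "\<And>h q. 0 < h \<Longrightarrow> h < 1 \<Longrightarrow>
      cmod (of_real (exp (\<epsilon> * wkb_weight \<beta> q / h)) *
        (magnetic_expr h (radial_potential \<beta>) (quasimode h) q - of_real (wkb_eigenvalue \<beta> m J h) * quasimode h q))
      \<le> C * h ^ (J + 2) * indicator (cball 0 (sqrt (2 * (K + 1)))) q"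
proof -
  obtain M where M: "0 \<le> M" "\<And>r. 0 \<le> r \<Longrightarrow> r \<le> K + 1 \<Longrightarrow> majorant r \<le> M"
    using majorant_bound by blast
  define R where "R = sqrt (2 * (K + 1))"
  have R: "0 < R" using K by (simp add: R_def)
  \<comment> \<open>The least value of \<open>(1 - \<epsilon>) * phase \<beta> r\<close> for
    \<open>r \<ge> K\<close>, by monotonicity of the phase.\<close>
  define \<kappa> where "\<kappa> = (1 - \<epsilon>) * phase \<beta> K"
  have \<kappa>: "0 < \<kappa>" using \<epsilon> K phase_pos by (simp add: \<kappa>_def)
  \<comment> \<open>The constant for which \<open>exp (- \<kappa> / h)\<close> is at most
    \<open>D * h ^ (J + 2)\<close>; the final factor \<open>1 + D\<close> then accommodates both
    cases below.\<close>
  define D where "D = fact (J + 2) / \<kappa> ^ (J + 2)"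
  have D: "0 \<le> D" using \<kappa> by (simp add: D_def)
  have "cmod (of_real (exp (\<epsilon> * wkb_weight \<beta> q / h)) *
        (magnetic_expr h (radial_potential \<beta>) (quasimode h) q - of_real (wkb_eigenvalue \<beta> m J h) * quasimode h q))
      \<le> R ^ m * ((1 + D) * M) * h ^ (J + 2) * indicator (cball 0 R) q"
    (is "cmod (_ * ?E) \<le> _") if h: "0 < h" "h < 1" for h q
  proof (cases "norm q \<le> R")
    case False
    then have "?E = 0"
      using quasimode_support[of q h] magnetic_expr_eq_0_outside[of R "quasimode h" q] quasimode_support
      by (simp add: R_def)
    then show ?thesis using False by simp
  next
    case True
    define r where "r = (norm q)\<^sup>2 / 2"
    have "(norm q)\<^sup>2 \<le> R\<^sup>2" using True by (intro power_mono) auto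
    then have r: "0 \<le> r" "r \<le> K + 1" using K by (auto simp: r_def R_def)
    have "cmod (of_real (exp (\<epsilon> * wkb_weight \<beta> q / h)) * ?E)
        = exp (\<epsilon> * phase \<beta> r / h) * (norm q ^ m * (exp (- phase \<beta> r / h) * \<bar>residual h r\<bar>))"
      unfolding quasimode_residual[OF h(1)]
      by (simp add: norm_mult norm_power norm_zcoord radial_def wkb_weight_def r_def abs_mult
          del: of_real_mult)
    also have "\<dots> = norm q ^ m * (exp (- ((1 - \<epsilon>) * phase \<beta> r / h)) * \<bar>residual h r\<bar>)"
    proof -
      have "exp (\<epsilon> * phase \<beta> r / h) * exp (- phase \<beta> r / h) = exp (- ((1 - \<epsilon>) * phase \<beta> r / h))"
        unfolding exp_add[symmetric] using h by (simp add: field_simps)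
      then show ?thesis by (simp add: mult_ac)
    qed
    also have "\<dots> \<le> R ^ m * ((1 + D) * M * h ^ (J + 2))"
    proof (rule mult_mono[OF power_mono[OF True]])
      show "exp (- ((1 - \<epsilon>) * phase \<beta> r / h)) * \<bar>residual h r\<bar> \<le> (1 + D) * M * h ^ (J + 2)"
      \<comment> \<open>The point \<open>r = K\<close> is put with the exponentially small case,
        because the fine estimate uses a neighbourhood on which the cutoff is 1.\<close>
      proof (cases "r < K")
        case True
        have "\<bar>residual h r\<bar> \<le> h ^ (J + 2) * M"
          by (rule order_trans[OF residual_fine[OF r(1) True h] mult_left_mono[OF M(2)[OF r]]])
             (use h in simp)
        moreover have "exp (- ((1 - \<epsilon>) * phase \<beta> r / h)) \<le> 1"
          using phase_nonneg[OF r(1)] \<epsilon> h by simp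
        ultimately have "exp (- ((1 - \<epsilon>) * phase \<beta> r / h)) * \<bar>residual h r\<bar> \<le> 1 * (h ^ (J + 2) * M)"
          by (intro mult_mono) auto
        also have "\<dots> \<le> (1 + D) * M * h ^ (J + 2)"
          using D M(1) h by (simp add: algebra_simps)
        finally show ?thesis .
      next
        case False
        have "\<kappa> / h \<le> (1 - \<epsilon>) * phase \<beta> r / h"
          using False K \<epsilon> h phase_mono[of K r] by (simp add: \<kappa>_def divide_right_mono)
        then have "exp (- ((1 - \<epsilon>) * phase \<beta> r / h)) \<le> exp (- (\<kappa> / h))" by simp
        also have "\<dots> \<le> fact (J + 2) / (\<kappa> / h) ^ (J + 2)"
          using \<kappa> h by (intro exp_minus_le_fact_div_power) simp
        also have "\<dots> = D * h ^ (J + 2)"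
          by (simp only: D_def power_divide divide_divide_eq_right times_divide_eq_left)
        finally have "exp (- ((1 - \<epsilon>) * phase \<beta> r / h)) * \<bar>residual h r\<bar> \<le> D * h ^ (J + 2) * M"
          using residual_crude[OF r(1) h] M(2)[OF r] D h by (intro mult_mono) auto
        also have "\<dots> \<le> (1 + D) * M * h ^ (J + 2)"
          using D M(1) h by (simp add: algebra_simps)
        finally show ?thesis .
      qed
    qed (use R in auto)
    finally show ?thesis using True by (simp add: mult_ac)
  qed
  then show thesis using that[of "R ^ m * ((1 + D) * M)"] R D M(1) by (simp add: R_def)
qed

end

section \<open>The estimate for every image under the closed operator\<close>

theorem corollary2p6:
  fixes \<beta> chi :: "real \<Rightarrow> real" and K :: real
  assumes "smooth_on UNIV \<beta>"
    and "\<And>r. \<beta> r > 0"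
    and "\<And>r. r > 0 \<Longrightarrow> \<beta> r > \<beta> 0"
    and "deriv \<beta> 0 > 0"
    and "K > 0"
    and "smooth_on {0..} chi"
    and "\<And>\<rho>. \<rho> \<in> {0..K} \<Longrightarrow> chi \<rho> = 1"
    and "\<And>\<rho>. \<rho> \<ge> K + 1 \<Longrightarrow> chi \<rho> = 0"
  shows "\<forall>\<epsilon>\<in>{0<..<1::real}. \<forall>m J :: nat. \<exists>C>0. \<exists>h0>0. \<forall>h\<in>{0<..<h0}.
    wkb_quasimode \<beta> chi m J h \<in> Domain (magnetic_laplacian h (radial_potential \<beta>)) \<and>
    (\<forall>v. (wkb_quasimode \<beta> chi m J h, v) \<in> magnetic_laplacian h (radial_potential \<beta>) \<longrightarrow>
      (let r = (\<lambda>q. v q - of_real (wkb_eigenvalue \<beta> m J h) * wkb_quasimode \<beta> chi m J h q);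
           w = (\<lambda>q. of_real (exp (\<epsilon> * wkb_weight \<beta> q / h)) * r q)
       in w \<in> L2_functions \<and> L2_norm w \<le> C * h ^ (J + 2) \<and>
          r \<in> L2_functions \<and> L2_norm r \<le> C * h ^ (J + 2)))"
proof (intro ballI allI)
  fix \<epsilon> :: real and m J :: nat
  assume \<epsilon>: "\<epsilon> \<in> {0<..<1}"
  interpret wkb_cutoff \<beta> chi K m J
    by unfold_locales (use assms smooth_on_subset[OF assms(1), of "{0..}"] in auto)
  let ?R = "sqrt (2 * (K + 1))" and ?L = "\<lambda>h. magnetic_expr h (radial_potential \<beta>)"
  let ?ind = "indicator (cball (0 :: real^2) ?R) :: real^2 \<Rightarrow> real"
  obtain C where C: "0 \<le> C" "\<And>h q. 0 < h \<Longrightarrow> h < 1 \<Longrightarrow>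
      cmod (of_real (exp (\<epsilon> * wkb_weight \<beta> q / h)) *
        (?L h (quasimode h) q - of_real (wkb_eigenvalue \<beta> m J h) * quasimode h q)) \<le> C * h ^ (J + 2) * ?ind q"
    using weighted_residual_bound[of \<epsilon>] \<epsilon> by auto
  define V where "V = sqrt (measure lborel (cball (0 :: real^2) ?R))"
  have V: "0 \<le> V" by (simp add: V_def)
  have weight_meas: "wkb_weight \<beta> \<in> borel_measurable borel"
    unfolding wkb_weight_def[abs_def]
    by (intro borel_measurable_continuous_onI continuous_on_compose2[OF smooth_on_imp_continuous_on[OF smooth_on_phase]]
        continuous_intros) auto
  have weight_nonneg: "0 \<le> wkb_weight \<beta> q" for q
    by (simp add: wkb_weight_def phase_nonneg)
  show "\<exists>C>0. \<exists>h0>0. \<forall>h\<in>{0<..<h0}.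
    quasimode h \<in> Domain (magnetic_laplacian h (radial_potential \<beta>)) \<and>
    (\<forall>v. (quasimode h, v) \<in> magnetic_laplacian h (radial_potential \<beta>) \<longrightarrow>
      (let r = (\<lambda>q. v q - of_real (wkb_eigenvalue \<beta> m J h) * quasimode h q);
           w = (\<lambda>q. of_real (exp (\<epsilon> * wkb_weight \<beta> q / h)) * r q)
       in w \<in> L2_functions \<and> L2_norm w \<le> C * h ^ (J + 2) \<and>
          r \<in> L2_functions \<and> L2_norm r \<le> C * h ^ (J + 2)))"
  \<comment> \<open>\<open>C * V\<close> is the pointwise constant times the root of the area of the
    supporting disc; adding 1 makes it strictly positive. The bounds hold for all
    \<open>h < 1\<close>.\<close>
  proof (rule exI[of _ "C * V + 1"], intro conjI exI[of _ "1 :: real"] ballI allI impI)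
    show "0 < C * V + 1" using C(1) V by (simp add: add_nonneg_pos)
    fix h :: real assume "h \<in> {0<..<1}"
    then have h: "0 < h" "h < 1" by auto
    show "quasimode h \<in> Domain (magnetic_laplacian h (radial_potential \<beta>))"
      by (intro test_functions_in_domain quasimode_test C_infty_radial_potential)
    fix v assume v: "(quasimode h, v) \<in> magnetic_laplacian h (radial_potential \<beta>)"
    define r where "r = (\<lambda>q. v q - of_real (wkb_eigenvalue \<beta> m J h) * quasimode h q)"
    define w where "w = (\<lambda>q. of_real (exp (\<epsilon> * wkb_weight \<beta> q / h)) * r q)"
    have AE_v: "v \<in> L2_functions" "AE q in lborel. v q = ?L h (quasimode h) q"
      using magnetic_laplacian_unique[OF quasimode_test C_infty_radial_potential v] by auto
    have w_AE: "AE q in lborel. cmod (w q) \<le> C * h ^ (J + 2) * ?ind q"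
      using AE_v(2)
    proof eventually_elim
      case (elim q)
      then show ?case using C(2)[OF h, of q] by (simp only: w_def r_def)
    qed
    \<comment> \<open>The phase is nonnegative, so the weight is at least 1 and the unweighted
      estimate follows with the same constant.\<close>
    have r_le_w: "cmod (r q) \<le> cmod (w q)" for q
    proof -
      have "1 \<le> exp (\<epsilon> * wkb_weight \<beta> q / h)" using \<epsilon> h weight_nonneg[of q] by simp
      then show ?thesis
        using mult_right_mono[of 1 "exp (\<epsilon> * wkb_weight \<beta> q / h)" "cmod (r q)"]
        by (simp add: w_def norm_mult)
    qed
    have r_AE: "AE q in lborel. cmod (r q) \<le> C * h ^ (J + 2) * ?ind q"
      using w_AE by eventually_elim (use r_le_w order_trans in blast)
    have qm: "quasimode h \<in> borel_measurable borel"
      using test_functions_subset_L2[OF quasimode_test] by (simp add: L2_functions_def)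
    have r_meas: "r \<in> borel_measurable borel"
      unfolding r_def using AE_v(1) qm by (auto simp: L2_functions_def)
    have w_meas: "w \<in> borel_measurable borel"
      unfolding w_def using r_meas weight_meas by auto
    have B: "0 \<le> C * h ^ (J + 2)" using C(1) h by simp
    have "C * h ^ (J + 2) * V \<le> (C * V + 1) * h ^ (J + 2)" using h by (simp add: algebra_simps)
    then have "w \<in> L2_functions \<and> L2_norm w \<le> (C * V + 1) * h ^ (J + 2) \<and>
        r \<in> L2_functions \<and> L2_norm r \<le> (C * V + 1) * h ^ (J + 2)"
      using L2_bounded_support[OF w_meas B w_AE] L2_bounded_support[OF r_meas B r_AE]
      unfolding V_def by linarith
    then show "let r = (\<lambda>q. v q - of_real (wkb_eigenvalue \<beta> m J h) * quasimode h q);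
           w = (\<lambda>q. of_real (exp (\<epsilon> * wkb_weight \<beta> q / h)) * r q)
       in w \<in> L2_functions \<and> L2_norm w \<le> (C * V + 1) * h ^ (J + 2) \<and>
          r \<in> L2_functions \<and> L2_norm r \<le> (C * V + 1) * h ^ (J + 2)"
      unfolding Let_def r_def[symmetric] w_def[symmetric] .
  qed simp_all
qed

end
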